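(* For every permutation $\pi$ there exists an integer $k_\pi = 2^{2^{O(|\pi|)}}$ such that every permutation $\sigma$ that avoids $\pi$ as a pattern is a product (composition) of at most $k_\pi$ separable permutations (of the same size as $\sigma$). Here the $O(\cdot)$ hides a universal constant.
   Context: A permutation $\pi\in\mathfrak{S}_n$ is a pattern of $\sigma\in\mathfrak{S}_m$ ($n\le m$) if there is an increasing function $f:[n]\to[m]$ such that for all $i,j\in[n]$, $\pi(i)<\pi(j)$ if and only if $\sigma(f(i))<\sigma(f(j))$. If $\pi$ is not a pattern of $\sigma$, then $\sigma$ avoids $\pi$. $|\pi|$ denotes the size $n$ of $\pi\in\mathfrak{S}_n$. A permutation is separable if it can be obtained from the one-element permutation $1$ by successively applying direct sums (placing two permutation matrices as diagonal blocks of a new permutation matrix) and skew sums (the same with antidiagonal blocks); equivalently, if it avoids both patterns $2413$ and $3142$. *)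

theory Defs
  imports "HOL-Combinatorics.Permutations"
begin

text \<open>
  A permutation of size \<open>n\<close> is a function \<open>p :: nat \<Rightarrow> nat\<close> with \<open>p permutes {1..n}\<close>. Such a \<open>p\<close> is
  the identity outside \<open>{1..n}\<close> and does not determine \<open>n\<close>, so the size is passed explicitly.
\<close>

definition pattern_of :: "nat \<Rightarrow> (nat \<Rightarrow> nat) \<Rightarrow> nat \<Rightarrow> (nat \<Rightarrow> nat) \<Rightarrow> bool" where
  "pattern_of n \<pi> m \<sigma> \<longleftrightarrow>
     (\<exists>f. f ` {1..n} \<subseteq> {1..m} \<and> strict_mono_on {1..n} f \<and>
          (\<forall>i\<in>{1..n}. \<forall>j\<in>{1..n}. \<pi> i < \<pi> j \<longleftrightarrow> \<sigma> (f i) < \<sigma> (f j)))"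

definition avoids :: "nat \<Rightarrow> (nat \<Rightarrow> nat) \<Rightarrow> nat \<Rightarrow> (nat \<Rightarrow> nat) \<Rightarrow> bool" where
  "avoids m \<sigma> n \<pi> \<longleftrightarrow> \<not> pattern_of n \<pi> m \<sigma>"

definition direct_sum :: "nat \<Rightarrow> (nat \<Rightarrow> nat) \<Rightarrow> nat \<Rightarrow> (nat \<Rightarrow> nat) \<Rightarrow> nat \<Rightarrow> nat" where
  "direct_sum m \<sigma> n \<tau> =
     (\<lambda>i. if i \<in> {1..m} then \<sigma> i
          else if i \<in> {m+1..m+n} then m + \<tau> (i - m)
          else i)"

definition skew_sum :: "nat \<Rightarrow> (nat \<Rightarrow> nat) \<Rightarrow> nat \<Rightarrow> (nat \<Rightarrow> nat) \<Rightarrow> nat \<Rightarrow> nat" where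
  "skew_sum m \<sigma> n \<tau> =
     (\<lambda>i. if i \<in> {1..m} then n + \<sigma> i
          else if i \<in> {m+1..m+n} then \<tau> (i - m)
          else i)"

inductive separable :: "nat \<Rightarrow> (nat \<Rightarrow> nat) \<Rightarrow> bool" where
  one: "separable 1 id"
| direct: "separable m \<sigma> \<Longrightarrow> separable n \<tau> \<Longrightarrow> separable (m + n) (direct_sum m \<sigma> n \<tau>)"
| skew: "separable m \<sigma> \<Longrightarrow> separable n \<tau> \<Longrightarrow> separable (m + n) (skew_sum m \<sigma> n \<tau>)"

lemma permutes_atLeastAtMostI:
  fixes p :: "nat \<Rightarrow> nat"
  assumes "\<And>i. i \<notin> {1..k} \<Longrightarrow> p i = i"
    and "\<And>i. i \<in> {1..k} \<Longrightarrow> p i \<in> {1..k}"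
    and "inj_on p {1..k}"
  shows "p permutes {1..k}"
proof (rule bij_imp_permutes)
  have "p ` {1..k} \<subseteq> {1..k}"
    using assms(2) by blast
  then show "bij_betw p {1..k} {1..k}"
    using assms(3) by (simp only: bij_betw_def endo_inj_surj finite_atLeastAtMost simp_thms)
qed (rule assms(1))

lemma direct_sum_permutes:
  assumes "\<sigma> permutes {1..m}" "\<tau> permutes {1..n}"
  shows "direct_sum m \<sigma> n \<tau> permutes {1..m + n}"
proof (rule permutes_atLeastAtMostI)
  have s: "\<sigma> i \<in> {1..m} \<longleftrightarrow> i \<in> {1..m}" and t: "\<tau> i \<in> {1..n} \<longleftrightarrow> i \<in> {1..n}" for i
    using permutes_in_image[OF assms(1)] permutes_in_image[OF assms(2)] by auto
  have si: "\<sigma> i = \<sigma> j \<longleftrightarrow> i = j" and ti: "\<tau> i = \<tau> j \<longleftrightarrow> i = j" for i j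
    using assms by (auto dest: permutes_inj simp: inj_eq)
  show "direct_sum m \<sigma> n \<tau> i = i" if "i \<notin> {1..m + n}" for i
    using that by (auto simp: direct_sum_def)
  show "direct_sum m \<sigma> n \<tau> i \<in> {1..m + n}" if "i \<in> {1..m + n}" for i
    using that s[of i] t[of "i - m"] by (auto simp: direct_sum_def)
  show "inj_on (direct_sum m \<sigma> n \<tau>) {1..m + n}"
  proof (rule inj_onI)
    fix i j assume "i \<in> {1..m + n}" "j \<in> {1..m + n}" "direct_sum m \<sigma> n \<tau> i = direct_sum m \<sigma> n \<tau> j"
    then show "i = j"
      using s[of i] t[of "i - m"] s[of j] t[of "j - m"] si[of i j] ti[of "i - m" "j - m"]
      by (auto simp: direct_sum_def split: if_splits)
  qed
qed

lemma skew_sum_permutes: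
  assumes "\<sigma> permutes {1..m}" "\<tau> permutes {1..n}"
  shows "skew_sum m \<sigma> n \<tau> permutes {1..m + n}"
proof (rule permutes_atLeastAtMostI)
  have s: "\<sigma> i \<in> {1..m} \<longleftrightarrow> i \<in> {1..m}" and t: "\<tau> i \<in> {1..n} \<longleftrightarrow> i \<in> {1..n}" for i
    using permutes_in_image[OF assms(1)] permutes_in_image[OF assms(2)] by auto
  have si: "\<sigma> i = \<sigma> j \<longleftrightarrow> i = j" and ti: "\<tau> i = \<tau> j \<longleftrightarrow> i = j" for i j
    using assms by (auto dest: permutes_inj simp: inj_eq)
  show "skew_sum m \<sigma> n \<tau> i = i" if "i \<notin> {1..m + n}" for i
    using that by (auto simp: skew_sum_def)
  show "skew_sum m \<sigma> n \<tau> i \<in> {1..m + n}" if "i \<in> {1..m + n}" for i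
    using that s[of i] t[of "i - m"] by (auto simp: skew_sum_def)
  show "inj_on (skew_sum m \<sigma> n \<tau>) {1..m + n}"
  proof (rule inj_onI)
    fix i j assume "i \<in> {1..m + n}" "j \<in> {1..m + n}" "skew_sum m \<sigma> n \<tau> i = skew_sum m \<sigma> n \<tau> j"
    then show "i = j"
      using s[of i] t[of "i - m"] s[of j] t[of "j - m"] si[of i j] ti[of "i - m" "j - m"]
      by (auto simp: skew_sum_def split: if_splits)
  qed
qed

lemma separable_permutes: "separable n \<sigma> \<Longrightarrow> \<sigma> permutes {1..n}"
proof (induction rule: separable.induct)
  case one
  show ?case by (rule permutes_id)
next
  case direct
  then show ?case by (intro direct_sum_permutes)
next
  case skew
  then show ?case by (intro skew_sum_permutes)
qed

end

theory Submission
  imports Defs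
begin

text \<open>
  Splitting a list into two classes takes two separable rearrangements, so a permutation that is
  increasing on each of \<open>2 ^ e\<close> colour classes is a product of \<open>4 * e\<close> separable ones. Products of
  a fixed number of separable permutations are moreover closed under substitution.

  For the general case cut the positions recursively: a piece \<open>J\<close> of a larger interval \<open>J \<union> Z\<close> is cut
  into the maximal runs whose values lie in one gap of the values of \<open>Z\<close>. Sorting the runs of every
  piece by their gap, and then merging the runs of different pieces, writes the permutation as a
  product of two iterated substitutions. Every inversion of a permutation substituted in the first
  one is separated in value by a point to its left or right, and every inversion of one substituted
  in the second is separated in position by a point above or below. So if the substituted
  permutations are factored in the same way, each step adds a column, or a row, to a grid of
  nonempty cells, at the cost of a constant factor in its length. As a grid with \<open>n\<close> rows and \<open>n\<close>
  columns contains every pattern of size \<open>n\<close>, this stops after \<open>2 * n\<close> steps at permutations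
  that have few inversions with pairwise disjoint ranges, and these need few colours.
\<close>

section \<open>Separable rearrangements of lists\<close>

text \<open>\<open>separable\<close> has no permutation of size 0, but a filter may leave an empty
  class. \<open>Nil\<close> lets such classes pass through the recursion;
  \<open>sep_rearr_separable\<close> discards them.\<close>

inductive sep_rearr :: "'a list \<Rightarrow> 'a list \<Rightarrow> bool" where
  Nil: "sep_rearr [] []"
| single: "sep_rearr [x] [x]"
| direct: "sep_rearr xs ys \<Longrightarrow> sep_rearr xs' ys' \<Longrightarrow> sep_rearr (xs @ xs') (ys @ ys')"
| skew: "sep_rearr xs ys \<Longrightarrow> sep_rearr xs' ys' \<Longrightarrow> sep_rearr (xs @ xs') (ys' @ ys)"

lemma sep_rearr_refl: "sep_rearr xs xs"
proof (induction xs)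
  case (Cons x xs)
  show ?case using sep_rearr.direct[OF sep_rearr.single Cons, of x] by simp
qed (rule sep_rearr.Nil)

lemma sep_rearr_rev: "sep_rearr (rev xs) xs"
proof (induction xs)
  case (Cons x xs)
  show ?case using sep_rearr.skew[OF Cons sep_rearr.single, of x] by simp
qed (simp add: sep_rearr.Nil)

lemma sep_rearr_sym: "sep_rearr xs ys \<Longrightarrow> sep_rearr ys xs"
  by (induction rule: sep_rearr.induct) (auto intro: sep_rearr.intros)

lemma sep_rearr_set: "sep_rearr xs ys \<Longrightarrow> set xs = set ys"
  by (induction rule: sep_rearr.induct) auto

lemma sep_rearr_length: "sep_rearr xs ys \<Longrightarrow> length xs = length ys"
  by (induction rule: sep_rearr.induct) auto

section \<open>Products of separable rearrangements\<close>

lemma sep_rearr_pow_set: "(sep_rearr ^^ n) xs ys \<Longrightarrow> set xs = set ys"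
  by (induction n arbitrary: ys) (auto dest: sep_rearr_set)

lemma sep_rearr_pow_refl: "(sep_rearr ^^ n) xs xs"
  by (induction n) (auto intro: sep_rearr_refl)

text \<open>Identity factors serve as padding, so that factorizations of different lengths can run
  in parallel.\<close>

lemma sep_rearr_pow_mono:
  assumes "(sep_rearr ^^ m) xs ys" "m \<le> n"
  shows "(sep_rearr ^^ n) xs ys"
proof -
  have "(sep_rearr ^^ (m + (n - m))) xs ys"
    unfolding relpowp_add using assms(1) sep_rearr_pow_refl by blast
  then show ?thesis using assms(2) by simp
qed

lemma sep_rearr_pow_trans:
  "(sep_rearr ^^ m) xs ys \<Longrightarrow> (sep_rearr ^^ n) ys zs \<Longrightarrow> (sep_rearr ^^ (m + n)) xs zs"
  unfolding relpowp_add by blast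

lemma sep_rearr_pow_sym: "(sep_rearr ^^ n) xs ys \<Longrightarrow> (sep_rearr ^^ n) ys xs"
proof (induction n arbitrary: ys)
  case (Suc n)
  then obtain zs where "(sep_rearr ^^ n) xs zs" "sep_rearr zs ys" by auto
  then have "sep_rearr ys zs" "(sep_rearr ^^ n) zs xs" using Suc.IH sep_rearr_sym by auto
  then show ?case by (rule relpowp_Suc_I2)
qed simp

lemma sep_rearr_pow_append:
  "(sep_rearr ^^ n) xs ys \<Longrightarrow> (sep_rearr ^^ n) xs' ys' \<Longrightarrow> (sep_rearr ^^ n) (xs @ xs') (ys @ ys')"
proof (induction n arbitrary: ys ys')
  case (Suc n)
  then obtain zs zs' where "(sep_rearr ^^ n) xs zs" "sep_rearr zs ys"
    "(sep_rearr ^^ n) xs' zs'" "sep_rearr zs' ys'" by auto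
  then have "(sep_rearr ^^ n) (xs @ xs') (zs @ zs')" "sep_rearr (zs @ zs') (ys @ ys')"
    using Suc.IH sep_rearr.direct by auto
  then show ?case by auto
qed simp

text \<open>A decomposition tree of the outer rearrangement becomes one of the whole list once the
  tree of each block is attached at its leaf.\<close>

lemma sep_rearr_concat_map:
  "sep_rearr cs ds \<Longrightarrow> \<forall>c\<in>set cs. sep_rearr (f c) (g c) \<Longrightarrow>
    sep_rearr (concat (map f cs)) (concat (map g ds))"
  by (induction rule: sep_rearr.induct) (auto intro: sep_rearr.intros)

text \<open>In every step the blocks move internally while the outer list is rearranged, so
  substitution costs no additional factors.\<close>

lemma sep_rearr_pow_concat_map:
  "(sep_rearr ^^ n) cs ds \<Longrightarrow> \<forall>c\<in>set cs. (sep_rearr ^^ n) (f c) (g c) \<Longrightarrow>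
    (sep_rearr ^^ n) (concat (map f cs)) (concat (map g ds))"
proof (induction n arbitrary: ds g)
  case 0
  then show ?case by (auto intro: arg_cong[where f = concat])
next
  case (Suc n)
  then obtain es where es: "(sep_rearr ^^ n) cs es" "sep_rearr es ds" by auto
  \<comment> \<open>\<open>h c\<close> will be the content of block \<open>c\<close> just before the
    last step.\<close>
  have "\<forall>c\<in>set cs. \<exists>h. (sep_rearr ^^ n) (f c) h \<and> sep_rearr h (g c)"
    using Suc.prems(2) by auto
  then obtain h where h: "\<forall>c\<in>set cs. (sep_rearr ^^ n) (f c) (h c) \<and> sep_rearr (h c) (g c)"
    by metis
  have "(sep_rearr ^^ n) (concat (map f cs)) (concat (map h es))"
    using Suc.IH[OF es(1)] h by blast
  moreover have "sep_rearr (concat (map h es)) (concat (map g ds))"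
    using sep_rearr_concat_map[OF es(2)] h sep_rearr_pow_set[OF es(1)] by blast
  ultimately show ?case by auto
qed

text \<open>Reading the list from left to right and putting each entry in front of or behind all
  previous ones is separable; it leaves one of the two parts reversed.\<close>

lemma sep_rearr_partition:
  "(sep_rearr ^^ 2) xs (filter P xs @ filter (\<lambda>x. \<not> P x) xs)"
proof -
  have "sep_rearr xs (rev (filter P xs) @ filter (\<lambda>x. \<not> P x) xs)"
  proof (induction xs rule: rev_induct)
    case (snoc x xs)
    show ?case
      using sep_rearr.skew[OF snoc sep_rearr.single, of x]
        sep_rearr.direct[OF snoc sep_rearr.single, of x] by simp
  qed (simp add: sep_rearr.Nil)
  moreover have "sep_rearr (rev (filter P xs) @ filter (\<lambda>x. \<not> P x) xs)
      (filter P xs @ filter (\<lambda>x. \<not> P x) xs)"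
    by (intro sep_rearr.direct sep_rearr_rev sep_rearr_refl)
  ultimately show ?thesis
    by (auto simp: numeral_2_eq_2)
qed

text \<open>The permutation sends the position of an entry in \<open>xs\<close> to its position in
  \<open>ys\<close>; the shifts by one reconcile list indices from 0 with permutations of
  \<open>{1..n}\<close>.\<close>

lemma sep_rearr_separable:
  "sep_rearr xs ys \<Longrightarrow> xs \<noteq> [] \<Longrightarrow>
    \<exists>\<tau>. separable (length xs) \<tau> \<and> (\<forall>i<length xs. xs ! i = ys ! (\<tau> (Suc i) - 1))"
proof (induction rule: sep_rearr.induct)
  case (single x)
  have "[x] ! i = [x] ! (id (Suc i) - 1)" if "i < length [x]" for i
    using that by simp
  then show ?case using separable.one by (metis One_nat_def length_Cons list.size(3))
next
  case (direct xs ys xs' ys')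
  consider "xs = []" | "xs' = []" | "xs \<noteq> []" "xs' \<noteq> []" by blast
  then show ?case
  proof cases
    case 1
    then show ?thesis using direct sep_rearr_length[OF direct.hyps(1)] by simp
  next
    case 2
    then show ?thesis using direct sep_rearr_length[OF direct.hyps(2)] by simp
  next
    case 3
    then obtain \<sigma> \<tau> where s: "separable (length xs) \<sigma>" "\<forall>i<length xs. xs ! i = ys ! (\<sigma> (Suc i) - 1)"
      and t: "separable (length xs') \<tau>" "\<forall>i<length xs'. xs' ! i = ys' ! (\<tau> (Suc i) - 1)"
      using direct.IH by auto
    have len: "length ys = length xs" "length ys' = length xs'"
      using direct.hyps sep_rearr_length by metis+
    have sr: "\<sigma> (Suc i) \<in> {1..length xs}" if "i < length xs" for i
      using permutes_in_image[OF separable_permutes[OF s(1)], of "Suc i"] that by auto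
    have tr: "\<tau> (Suc i) \<in> {1..length xs'}" if "i < length xs'" for i
      using permutes_in_image[OF separable_permutes[OF t(1)], of "Suc i"] that by auto
    have "(xs @ xs') ! i = (ys @ ys') ! (direct_sum (length xs) \<sigma> (length xs') \<tau> (Suc i) - 1)"
      if "i < length (xs @ xs')" for i
    proof (cases "i < length xs")
      case True
      then show ?thesis using s(2) sr[OF True] len
        by (auto simp: direct_sum_def nth_append)
    next
      case False
      then have i: "i - length xs < length xs'" using that by auto
      have e: "Suc i - length xs = Suc (i - length xs)" using False by auto
      show ?thesis using False that t(2)[rule_format, OF i] tr[OF i] len
        by (auto simp: direct_sum_def nth_append e)
    qed
    then show ?thesis using separable.direct[OF s(1) t(1)] by auto
  qed
next
  case (skew xs ys xs' ys')
  consider "xs = []" | "xs' = []" | "xs \<noteq> []" "xs' \<noteq> []" by blast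
  then show ?case
  proof cases
    case 1
    then show ?thesis using skew sep_rearr_length[OF skew.hyps(1)] by simp
  next
    case 2
    then show ?thesis using skew sep_rearr_length[OF skew.hyps(2)] by simp
  next
    case 3
    then obtain \<sigma> \<tau> where s: "separable (length xs) \<sigma>" "\<forall>i<length xs. xs ! i = ys ! (\<sigma> (Suc i) - 1)"
      and t: "separable (length xs') \<tau>" "\<forall>i<length xs'. xs' ! i = ys' ! (\<tau> (Suc i) - 1)"
      using skew.IH by auto
    have len: "length ys = length xs" "length ys' = length xs'"
      using skew.hyps sep_rearr_length by metis+
    have sr: "\<sigma> (Suc i) \<in> {1..length xs}" if "i < length xs" for i
      using permutes_in_image[OF separable_permutes[OF s(1)], of "Suc i"] that by auto
    have tr: "\<tau> (Suc i) \<in> {1..length xs'}" if "i < length xs'" for i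
      using permutes_in_image[OF separable_permutes[OF t(1)], of "Suc i"] that by auto
    have "(xs @ xs') ! i = (ys' @ ys) ! (skew_sum (length xs) \<sigma> (length xs') \<tau> (Suc i) - 1)"
      if "i < length (xs @ xs')" for i
    proof (cases "i < length xs")
      case True
      then show ?thesis using s(2) sr[OF True] len
        by (auto simp: skew_sum_def nth_append)
    next
      case False
      then have i: "i - length xs < length xs'" using that by auto
      have e: "Suc i - length xs = Suc (i - length xs)" using False by auto
      show ?thesis using False that t(2)[rule_format, OF i] tr[OF i] len
        by (auto simp: skew_sum_def nth_append e)
    qed
    then show ?thesis using separable.skew[OF s(1) t(1)] by auto
  qed
qed simp

lemma foldr_comp_permutes:
  "\<forall>\<tau>\<in>set \<tau>s. \<tau> permutes S \<Longrightarrow> foldr (\<circ>) \<tau>s id permutes S"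
proof (induction \<tau>s)
  case (Cons \<tau> \<tau>s)
  then have "foldr (\<circ>) \<tau>s id permutes S" "\<tau> permutes S"
    by (meson list.set_intros)+
  then have "\<tau> \<circ> foldr (\<circ>) \<tau>s id permutes S"
    by (rule permutes_compose)
  then show ?case by (metis foldr_Cons comp_apply)
qed (simp only: foldr.simps id_apply permutes_id)

lemma sep_rearr_pow_separable:
  assumes "xs \<noteq> []"
  shows "(sep_rearr ^^ n) xs ys \<Longrightarrow>
    \<exists>\<tau>s. length \<tau>s = n \<and> (\<forall>\<tau>\<in>set \<tau>s. separable (length xs) \<tau>) \<and> length ys = length xs \<and>
      (\<forall>i<length xs. xs ! i = ys ! (foldr (\<circ>) \<tau>s id (Suc i) - 1))"
proof (induction n arbitrary: ys)
  case (Suc n)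
  then obtain zs where z: "(sep_rearr ^^ n) xs zs" "sep_rearr zs ys" by auto
  obtain \<tau>s where ts: "length \<tau>s = n" "\<forall>\<tau>\<in>set \<tau>s. separable (length xs) \<tau>" "length zs = length xs"
    "\<And>i. i<length xs \<Longrightarrow> xs ! i = zs ! (foldr (\<circ>) \<tau>s id (Suc i) - 1)"
    using Suc.IH[OF z(1)] by blast
  have "zs \<noteq> []" using ts(3) assms by auto
  then obtain \<tau> where t: "separable (length xs) \<tau>"
    "\<And>i. i<length xs \<Longrightarrow> zs ! i = ys ! (\<tau> (Suc i) - 1)"
    using sep_rearr_separable[OF z(2)] ts(3) by auto
  have p: "foldr (\<circ>) \<tau>s id permutes {1..length xs}"
    using ts(2) separable_permutes by (intro foldr_comp_permutes) blast
  \<comment> \<open>\<open>foldr\<close> applies the head of the list last, so the most recent step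
    is put in front.\<close>
  have "xs ! i = ys ! (foldr (\<circ>) (\<tau> # \<tau>s) id (Suc i) - 1)" if i: "i < length xs" for i
  proof -
    let ?j = "foldr (\<circ>) \<tau>s id (Suc i)"
    have j: "?j \<in> {1..length xs}"
      using permutes_in_image[OF p, of "Suc i"] i by auto
    then have "zs ! (?j - 1) = ys ! (\<tau> (Suc (?j - 1)) - 1)"
      by (intro t(2)) auto
    then show ?thesis using ts(4)[OF i] j by (simp only: foldr.simps o_apply) simp
  qed
  moreover have "length ys = length xs" using ts(3) sep_rearr_length[OF z(2)] by simp
  moreover have "length (\<tau> # \<tau>s) = Suc n" "\<forall>\<rho>\<in>set (\<tau> # \<tau>s). separable (length xs) \<rho>"
    using ts(1,2) t(1) by auto
  ultimately show ?case by blast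
qed simp

section \<open>Rearrangements between two orders\<close>

definition enumerates :: "('a \<Rightarrow> nat) \<Rightarrow> 'a set \<Rightarrow> 'a list \<Rightarrow> bool" where
  "enumerates f X xs \<longleftrightarrow> set xs = X \<and> sorted_wrt (\<lambda>a b. f a < f b) xs"

lemma enumerates_exists:
  assumes "finite X" "inj_on f X"
  shows "\<exists>xs. enumerates f X xs"
  using assms
proof (induction "card X" arbitrary: X)
  case 0
  then show ?case by (intro exI[of _ "[]"]) (auto simp: enumerates_def)
next
  case (Suc n)
  then have "X \<noteq> {}" by auto
  then obtain x where x: "x \<in> X" "\<And>y. y \<in> X \<Longrightarrow> f x \<le> f y"
    using ex_has_least_nat[of "\<lambda>x. x \<in> X" _ f] by blast
  have "n = card (X - {x})" using Suc x by auto
  moreover have "inj_on f (X - {x})" using Suc.prems(2) by (auto simp: inj_on_def)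
  ultimately obtain xs where xs: "enumerates f (X - {x}) xs"
    using Suc.hyps(1)[of "X - {x}"] Suc.prems(1) by auto
  have "f x < f y" if "y \<in> X - {x}" for y
    using x Suc.prems(2) that by (metis DiffD1 DiffD2 inj_onD insertI1 le_neq_implies_less)
  then have "enumerates f X (x # xs)"
    using xs x(1) by (auto simp: enumerates_def)
  then show ?case ..
qed

lemma enumerates_unique:
  "enumerates f X xs \<Longrightarrow> enumerates f X ys \<Longrightarrow> xs = ys"
proof (induction xs arbitrary: X ys)
  case Nil
  then show ?case by (auto simp: enumerates_def)
next
  case (Cons x xs)
  then obtain y ys' where ys: "ys = y # ys'"
    by (cases ys) (auto simp: enumerates_def)
  have xy: "x = y"
  proof (rule ccontr)
    assume "x \<noteq> y"
    moreover have "y \<in> set (x # xs)" "x \<in> set (y # ys')"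
      using Cons.prems ys by (auto simp: enumerates_def)
    ultimately have "f x < f y" "f y < f x"
      using Cons.prems ys by (auto simp: enumerates_def)
    then show False by simp
  qed
  have "x \<notin> set xs" "x \<notin> set ys'"
    using Cons.prems ys xy by (auto simp: enumerates_def)
  then have "enumerates f (X - {x}) xs" "enumerates f (X - {x}) ys'"
    using Cons.prems ys xy by (auto simp: enumerates_def)
  then show ?case using Cons.IH ys xy by blast
qed

lemma enumerates_cong:
  assumes "\<And>x y. x \<in> X \<Longrightarrow> y \<in> X \<Longrightarrow> f x < f y \<longleftrightarrow> g x < g y"
  shows "enumerates f X xs \<longleftrightarrow> enumerates g X xs"
  unfolding enumerates_def using assms
  by (metis (no_types, lifting) sorted_wrt_mono_rel)

lemma enumerates_filter:
  "enumerates f X xs \<Longrightarrow> enumerates f {x\<in>X. P x} (filter P xs)"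
  by (auto simp: enumerates_def sorted_wrt_filter)

lemma enumerates_concat_map:
  assumes "enumerates F C cs" "\<And>c. c \<in> C \<Longrightarrow> enumerates f {x\<in>X. \<kappa> x = c} (g c)"
    and "\<And>x y. x \<in> X \<Longrightarrow> y \<in> X \<Longrightarrow> F (\<kappa> x) < F (\<kappa> y) \<Longrightarrow> f x < f y"
    and "\<kappa> ` X = C"
  shows "enumerates f X (concat (map g cs))"
proof -
  have "sorted_wrt (\<lambda>a b. f a < f b) (concat (map g cs))"
    if "sorted_wrt (\<lambda>a b. F a < F b) cs" "set cs \<subseteq> C" for cs
    using that
  proof (induction cs)
    case (Cons c cs)
    then show ?case using assms(2)
      by (auto simp: sorted_wrt_append enumerates_def intro!: assms(3))
  qed simp
  moreover have "set (concat (map g cs)) = X"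
    using assms(1,2,4) by (fastforce simp: enumerates_def)
  ultimately show ?thesis using assms(1) by (auto simp: enumerates_def)
qed

text \<open>Ranging over all enumerations ties the notion to the two orders alone. An order that is
  not injective on \<open>X\<close> has no enumeration and makes it vacuous, so injectivity and
  finiteness are carried along wherever an enumeration must exist.\<close>

definition rearr :: "nat \<Rightarrow> ('a \<Rightarrow> nat) \<Rightarrow> ('a \<Rightarrow> nat) \<Rightarrow> 'a set \<Rightarrow> bool" where
  "rearr n p v X \<longleftrightarrow>
    (\<forall>xs ys. enumerates p X xs \<longrightarrow> enumerates v X ys \<longrightarrow> (sep_rearr ^^ n) xs ys)"

lemma rearr_mono: "rearr m p v X \<Longrightarrow> m \<le> n \<Longrightarrow> rearr n p v X"
  unfolding rearr_def using sep_rearr_pow_mono by blast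

lemma rearr_sym: "rearr n p v X \<Longrightarrow> rearr n v p X"
  unfolding rearr_def using sep_rearr_pow_sym by blast

lemma rearr_trans:
  assumes "rearr m p q X" "rearr n q v X" "finite X" "inj_on q X"
  shows "rearr (m + n) p v X"
  unfolding rearr_def
  using assms sep_rearr_pow_trans enumerates_exists[OF assms(3,4)] unfolding rearr_def by blast

lemma rearr_cong:
  assumes "\<And>x y. x \<in> X \<Longrightarrow> y \<in> X \<Longrightarrow> p x < p y \<longleftrightarrow> p' x < p' y"
    and "\<And>x y. x \<in> X \<Longrightarrow> y \<in> X \<Longrightarrow> v x < v y \<longleftrightarrow> v' x < v' y"
  shows "rearr n p v X \<longleftrightarrow> rearr n p' v' X"
  unfolding rearr_def using enumerates_cong[of X p p'] enumerates_cong[of X v v'] assms by simp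

lemma rearr_refl:
  assumes "\<And>x y. x \<in> X \<Longrightarrow> y \<in> X \<Longrightarrow> p x < p y \<longleftrightarrow> v x < v y"
  shows "rearr n p v X"
  unfolding rearr_def
  using enumerates_cong[of X p v, OF assms] enumerates_unique sep_rearr_pow_refl by metis

text \<open>\<open>\<kappa>\<close> labels the blocks, and \<open>P\<close> and \<open>V\<close>
  order the labels as \<open>p\<close> and \<open>v\<close> order the blocks. Labels and block
  contents are rearranged simultaneously, so one \<open>n\<close> serves for both.\<close>

lemma rearr_subst:
  assumes "finite X" "inj_on p X" "inj_on v X" "inj_on P (\<kappa> ` X)" "inj_on V (\<kappa> ` X)"
    and "rearr n P V (\<kappa> ` X)" "\<And>c. c \<in> \<kappa> ` X \<Longrightarrow> rearr n p v {x\<in>X. \<kappa> x = c}"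
    and "\<And>x y. x \<in> X \<Longrightarrow> y \<in> X \<Longrightarrow> P (\<kappa> x) < P (\<kappa> y) \<Longrightarrow> p x < p y"
    and "\<And>x y. x \<in> X \<Longrightarrow> y \<in> X \<Longrightarrow> V (\<kappa> x) < V (\<kappa> y) \<Longrightarrow> v x < v y"
  shows "rearr n p v X"
proof -
  obtain cs ds where cs: "enumerates P (\<kappa> ` X) cs" and ds: "enumerates V (\<kappa> ` X) ds"
    using assms(1,4,5) enumerates_exists by (metis finite_imageI)
  have inj: "inj_on p {x\<in>X. \<kappa> x = c}" "inj_on v {x\<in>X. \<kappa> x = c}" "finite {x\<in>X. \<kappa> x = c}" for c
    using assms(1-3) by (auto simp: inj_on_def)
  obtain f where f: "\<And>c. enumerates p {x\<in>X. \<kappa> x = c} (f c)"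
    using enumerates_exists[OF inj(3,1)] by metis
  obtain g where g: "\<And>c. enumerates v {x\<in>X. \<kappa> x = c} (g c)"
    using enumerates_exists[OF inj(3,2)] by metis
  have "(sep_rearr ^^ n) (concat (map f cs)) (concat (map g ds))"
  proof (rule sep_rearr_pow_concat_map)
    show "(sep_rearr ^^ n) cs ds" using assms(6) cs ds unfolding rearr_def by blast
    show "\<forall>c\<in>set cs. (sep_rearr ^^ n) (f c) (g c)"
      using assms(7) f g cs unfolding rearr_def enumerates_def[of P] by blast
  qed
  moreover have "enumerates p X (concat (map f cs))"
    by (rule enumerates_concat_map[OF cs f assms(8)]) auto
  moreover have "enumerates v X (concat (map g ds))"
    by (rule enumerates_concat_map[OF ds g assms(9)]) auto
  ultimately show ?thesis unfolding rearr_def using enumerates_unique by metis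
qed

text \<open>The top bit of the colour splits both lists into two classes. Two steps gather the
  classes of the \<open>p\<close>-list, both classes are treated recursively in parallel, and two
  steps undo the gathering of the \<open>v\<close>-list: four steps per bit.\<close>

lemma rearr_colour:
  fixes c :: "'a \<Rightarrow> nat"
  assumes "\<And>x. x \<in> X \<Longrightarrow> c x < 2 ^ e"
    and "\<And>x y. x \<in> X \<Longrightarrow> y \<in> X \<Longrightarrow> c x = c y \<Longrightarrow> p x < p y \<Longrightarrow> v x < v y"
    and "inj_on p X" "inj_on v X"
  shows "rearr (4 * e) p v X"
  using assms
proof (induction e arbitrary: X c)
  case 0
  have "p x < p y \<longleftrightarrow> v x < v y" if "x \<in> X" "y \<in> X" for x y
    using 0(1)[of x] 0(1)[of y] 0(2)[of x y] 0(2)[of y x] that inj_onD[OF 0(3), of x y]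
    by (cases "p x" "p y" rule: linorder_cases) auto
  then show ?case by (rule rearr_refl)
next
  case (Suc e)
  let ?P = "\<lambda>x. c x < 2 ^ e"
  have 1: "rearr (4 * e) p v {x\<in>X. ?P x}"
    by (rule Suc.IH[of _ c]) (use Suc.prems in \<open>auto simp: inj_on_def\<close>)
  have 2: "rearr (4 * e) p v {x\<in>X. \<not> ?P x}"
  proof (rule Suc.IH[of _ "\<lambda>x. c x - 2 ^ e"])
    show "c x - 2 ^ e < 2 ^ e" if "x \<in> {x\<in>X. \<not> ?P x}" for x
      using Suc.prems(1)[of x] that by simp
    show "v x < v y" if "x \<in> {x\<in>X. \<not> ?P x}" "y \<in> {x\<in>X. \<not> ?P x}" "c x - 2 ^ e = c y - 2 ^ e" "p x < p y" for x y
      using Suc.prems(2)[of x y] that by (simp add: eq_diff_iff)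
  qed (use Suc.prems in \<open>auto simp: inj_on_def\<close>)
  show ?case
    unfolding rearr_def
  proof (intro allI impI)
    fix xs ys assume xy: "enumerates p X xs" "enumerates v X ys"
    have "(sep_rearr ^^ (4 * e)) (filter ?P xs @ filter (\<lambda>x. \<not> ?P x) xs)
        (filter ?P ys @ filter (\<lambda>x. \<not> ?P x) ys)"
      using 1 2 xy[THEN enumerates_filter, of ?P] xy[THEN enumerates_filter, of "\<lambda>x. \<not> ?P x"]
      unfolding rearr_def by (intro sep_rearr_pow_append) simp_all
    then have "(sep_rearr ^^ (2 + 4 * e + 2)) xs ys"
      using sep_rearr_pow_trans sep_rearr_partition sep_rearr_pow_sym by metis
    moreover have "2 + 4 * e + 2 = 4 * Suc e" by simp
    ultimately show "(sep_rearr ^^ (4 * Suc e)) xs ys" by metis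
  qed
qed

section \<open>Grids\<close>

definition before :: "('a \<Rightarrow> nat) \<Rightarrow> 'a set \<Rightarrow> 'a set \<Rightarrow> bool" where
  "before f A B \<longleftrightarrow> (\<forall>a\<in>A. \<forall>b\<in>B. f a < f b)"

text \<open>The count numbers the gaps between consecutive values of \<open>Z\<close> from below;
  for empty \<open>Z\<close> every point lies in gap 0.\<close>

definition gap :: "('a \<Rightarrow> nat) \<Rightarrow> 'a set \<Rightarrow> 'a \<Rightarrow> nat" where
  "gap v Z x = card {z\<in>Z. v z < v x}"

lemma gap_mono: "finite Z \<Longrightarrow> v x \<le> v y \<Longrightarrow> gap v Z x \<le> gap v Z y"
  unfolding gap_def by (rule card_mono) auto

lemma gap_less_separated:
  assumes "finite Z" "gap v Z x < gap v Z y"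
  shows "\<exists>z\<in>Z. v x \<le> v z \<and> v z < v y"
proof (rule ccontr)
  assume "\<not> ?thesis"
  then have "{z\<in>Z. v z < v y} \<subseteq> {z\<in>Z. v z < v x}" by force
  then have "gap v Z y \<le> gap v Z x" unfolding gap_def using assms(1) by (intro card_mono) auto
  then show False using assms(2) by simp
qed

lemma gap_less_imp_less: "finite Z \<Longrightarrow> gap v Z x < gap v Z y \<Longrightarrow> v x < v y"
  using gap_mono[of Z v y x] by force

text \<open>The points of \<open>Z\<close> lie to the left and to the right of \<open>R\<close> and cut the values of \<open>R\<close> into gaps;
  \<open>v'\<close> only remembers the gap of a point and breaks ties increasingly.\<close>

definition coarse :: "('a \<Rightarrow> nat) \<Rightarrow> ('a \<Rightarrow> nat) \<Rightarrow> 'a set \<Rightarrow> 'a set \<Rightarrow> ('a \<Rightarrow> nat) \<Rightarrow> bool" where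
  "coarse p v R Z v' \<longleftrightarrow>
    (\<forall>z\<in>Z. (\<forall>r\<in>R. p z < p r) \<or> (\<forall>r\<in>R. p r < p z)) \<and>
    (\<forall>x\<in>R. \<forall>y\<in>R. v' x < v' y \<longleftrightarrow>
      gap v Z x < gap v Z y \<or> gap v Z x = gap v Z y \<and> p x < p y)"

text \<open>The inversion in each row supplies the separating point from which a new column is
  built. It also gives meaning to a grid without columns: \<open>grid 0 s\<close> asks for
  \<open>s\<close> inversions with disjoint ranges of values.\<close>

definition grid :: "nat \<Rightarrow> nat \<Rightarrow> ('a \<Rightarrow> nat) \<Rightarrow> ('a \<Rightarrow> nat) \<Rightarrow> 'a set \<Rightarrow> bool" where
  "grid a s p v X \<longleftrightarrow> (\<exists>C W. (\<forall>i<a. C i \<subseteq> X) \<and> (\<forall>l<s. W l \<subseteq> X) \<and>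
    (\<forall>i j. i < j \<longrightarrow> j < a \<longrightarrow> before p (C i) (C j)) \<and>
    (\<forall>k l. k < l \<longrightarrow> l < s \<longrightarrow> before v (W k) (W l)) \<and>
    (\<forall>i<a. \<forall>l<s. C i \<inter> W l \<noteq> {}) \<and>
    (\<forall>l<s. \<exists>x\<in>W l. \<exists>y\<in>W l. p x < p y \<and> v y < v x))"

lemma gridE:
  assumes "grid a s p v X"
  obtains C W where "\<And>i. i < a \<Longrightarrow> C i \<subseteq> X" "\<And>l. l < s \<Longrightarrow> W l \<subseteq> X"
    "\<And>i j. i < j \<Longrightarrow> j < a \<Longrightarrow> before p (C i) (C j)"
    "\<And>k l. k < l \<Longrightarrow> l < s \<Longrightarrow> before v (W k) (W l)"
    "\<And>i l. i < a \<Longrightarrow> l < s \<Longrightarrow> C i \<inter> W l \<noteq> {}"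
    "\<And>l. l < s \<Longrightarrow> \<exists>x\<in>W l. \<exists>y\<in>W l. p x < p y \<and> v y < v x"
proof -
  obtain C W where "(\<forall>i<a. C i \<subseteq> X) \<and> (\<forall>l<s. W l \<subseteq> X) \<and>
    (\<forall>i j. i < j \<longrightarrow> j < a \<longrightarrow> before p (C i) (C j)) \<and>
    (\<forall>k l. k < l \<longrightarrow> l < s \<longrightarrow> before v (W k) (W l)) \<and>
    (\<forall>i<a. \<forall>l<s. C i \<inter> W l \<noteq> {}) \<and>
    (\<forall>l<s. \<exists>x\<in>W l. \<exists>y\<in>W l. p x < p y \<and> v y < v x)"
    using assms unfolding grid_def by (elim exE) (rule that)
  then show ?thesis by (intro that[of C W]) simp_all
qed

text \<open>Rows indexed by any finite set of numbers allow passing to a subfamily without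
  renumbering; \<open>h\<close> enumerates the set increasingly.\<close>

lemma gridI:
  fixes S :: "nat set"
  assumes "finite S" "s \<le> card S" "\<And>i. i < a \<Longrightarrow> C i \<subseteq> X" "\<And>l. l \<in> S \<Longrightarrow> W l \<subseteq> X"
    and "\<And>i j. i < j \<Longrightarrow> j < a \<Longrightarrow> before p (C i) (C j)"
    and "\<And>k l. k \<in> S \<Longrightarrow> l \<in> S \<Longrightarrow> k < l \<Longrightarrow> before v (W k) (W l)"
    and "\<And>i l. i < a \<Longrightarrow> l \<in> S \<Longrightarrow> C i \<inter> W l \<noteq> {}"
    and "\<And>l. l \<in> S \<Longrightarrow> \<exists>x\<in>W l. \<exists>y\<in>W l. p x < p y \<and> v y < v x"
  shows "grid a s p v X"
proof -
  define h where "h k = sorted_list_of_set S ! k" for k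
  have len: "length (sorted_list_of_set S) = card S" by simp
  have h: "h k \<in> S" if "k < s" for k
    using that assms(1,2) nth_mem[of k "sorted_list_of_set S"] by (simp add: h_def)
  have hm: "h k < h l" if "k < l" "l < s" for k l
    using that assms(2) len unfolding h_def
    by (intro sorted_wrt_nth_less[OF strict_sorted_list_of_set]) auto
  show ?thesis unfolding grid_def
    by (rule exI[of _ C], rule exI[of _ "\<lambda>k. W (h k)"], intro conjI allI impI)
      (use assms h hm in \<open>auto\<close>)
qed

lemma grid_mono:
  assumes "grid a s p v X" "t \<le> s"
  shows "grid a t p v X"
proof (rule gridE[OF assms(1)])
  fix C W
  assume "\<And>i. i < a \<Longrightarrow> C i \<subseteq> X" "\<And>l. l < s \<Longrightarrow> W l \<subseteq> X"
    "\<And>i j. i < j \<Longrightarrow> j < a \<Longrightarrow> before p (C i) (C j)"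
    "\<And>k l. k < l \<Longrightarrow> l < s \<Longrightarrow> before v (W k) (W l)"
    "\<And>i l. i < a \<Longrightarrow> l < s \<Longrightarrow> C i \<inter> W l \<noteq> {}"
    "\<And>l. l < s \<Longrightarrow> \<exists>x\<in>W l. \<exists>y\<in>W l. p x < p y \<and> v y < v x"
  then show ?thesis using assms(2)
    by (intro gridI[of "{..<t}" t a C X W]) simp_all
qed

text \<open>Ties of \<open>v'\<close> follow \<open>p\<close>, so an inversion for \<open>v'\<close>
  joins different gaps and straddles the value of a point of \<open>Z\<close>. That point lies left
  or right of all of \<open>R\<close>; such points on one side form the new column. Keeping every
  other row and then one side costs the factor 4.\<close>

lemma grid_coarse_values:
  assumes fin: "finite Z" and sub: "R \<subseteq> X" "Z \<subseteq> X" and inj: "inj_on v X"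
    and co: "coarse p v R Z v'" and gr: "grid a (4 * s) p v' R"
  shows "grid (Suc a) s p v X"
proof -
  obtain C W where CR: "\<And>i. i < a \<Longrightarrow> C i \<subseteq> R" and WR: "\<And>l. l < 4 * s \<Longrightarrow> W l \<subseteq> R"
    and CC: "\<And>i j. i < j \<Longrightarrow> j < a \<Longrightarrow> before p (C i) (C j)"
    and WW: "\<And>k l. k < l \<Longrightarrow> l < 4 * s \<Longrightarrow> before v' (W k) (W l)"
    and CW: "\<And>i l. i < a \<Longrightarrow> l < 4 * s \<Longrightarrow> C i \<inter> W l \<noteq> {}"
    and inv': "\<And>l. l < 4 * s \<Longrightarrow> \<exists>x\<in>W l. \<exists>y\<in>W l. p x < p y \<and> v' y < v' x"
    by (rule gridE[OF gr]) (rule that; assumption)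
  obtain x y where xy: "\<And>l. l < 4 * s \<Longrightarrow> x l \<in> W l \<and> y l \<in> W l \<and> p (x l) < p (y l) \<and> v' (y l) < v' (x l)"
    using inv' by metis
  have le: "gap v Z a \<le> gap v Z b" if "a \<in> R" "b \<in> R" "v' a < v' b" for a b
    using co that unfolding coarse_def by fastforce
  have gxy: "gap v Z (y l) < gap v Z (x l)" if "l < 4 * s" for l
    using co xy[OF that] WR[OF that] unfolding coarse_def by (meson order_less_asym subsetD)
  have disj: "R \<inter> Z = {}" using co unfolding coarse_def by auto
  have "\<exists>z\<in>Z. v (y l) < v z \<and> v z < v (x l)" if l: "l < 4 * s" for l
  proof -
    obtain z where z: "z \<in> Z" "v (y l) \<le> v z" "v z < v (x l)"
      using gap_less_separated[OF fin gxy[OF l]] by blast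
    have "y l \<noteq> z" using xy[OF l] WR[OF l] z(1) disj by blast
    moreover have "y l \<in> X" "z \<in> X" using xy[OF l] WR[OF l] z(1) sub by auto
    ultimately have "v (y l) \<noteq> v z" using inj by (auto dest: inj_onD)
    then have "v (y l) < v z" using z(2) by simp
    then show ?thesis using z(1,3) by blast
  qed
  then obtain z where z: "\<And>l. l < 4 * s \<Longrightarrow> z l \<in> Z \<and> v (y l) < v (z l) \<and> v (z l) < v (x l)"
    by metis
  text \<open>Rows that are adjacent for \<open>v'\<close> may overlap for \<open>v\<close> because of ties, but an inversion in
    a row between them forces them into different gaps.\<close>
  have skip: "v b < v c" if "b \<in> W k" "c \<in> W l" "Suc k < l" "l < 4 * s" for b c k l
  proof -
    have m: "Suc k < 4 * s" and k: "k < 4 * s" using that by auto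
    have "b \<in> R" "c \<in> R" "x (Suc k) \<in> R" "y (Suc k) \<in> R"
      using that xy[OF m] WR[OF m] WR[OF k] WR[OF that(4)] by auto
    moreover have "v' b < v' (y (Suc k))" "v' (x (Suc k)) < v' c"
      using WW[of k "Suc k"] WW[OF that(3,4)] m that xy[OF m] unfolding before_def by auto
    ultimately have "gap v Z b < gap v Z c"
      using le gxy[OF m] by (meson le_less_trans less_le_trans)
    then show ?thesis by (rule gap_less_imp_less[OF fin])
  qed
  \<comment> \<open>Only even rows are kept, so that \<open>skip\<close> applies. The added point
    has its value between two values of its row, which keeps the rows in order.\<close>
  define W' where "W' k = insert (z (2 * k)) (W (2 * k))" for k
  have W'X: "W' k \<subseteq> X" if "k < 2 * s" for k
    using that WR[of "2 * k"] z[of "2 * k"] sub unfolding W'_def by auto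
  have W'W': "before v (W' k) (W' l)" if "k < l" "l < 2 * s" for k l
  proof -
    have "2 * k < 4 * s" "2 * l < 4 * s" "Suc (2 * k) < 2 * l" using that by auto
    note kl = xy[OF this(1)] xy[OF this(2)] z[OF this(1)] z[OF this(2)] skip[OF _ _ this(3,2)]
    have "v b < v c" if "b \<in> W' k" "c \<in> W' l" for b c
    proof -
      have "\<exists>b'\<in>W (2 * k). v b \<le> v b'" using that(1) kl(1,3) unfolding W'_def by (metis insertE less_imp_le order.refl)
      moreover have "\<exists>c'\<in>W (2 * l). v c' \<le> v c" using that(2) kl(2,4) unfolding W'_def by (metis insertE less_imp_le order.refl)
      ultimately show ?thesis using kl(5) by (meson le_less_trans less_le_trans)
    qed
    then show ?thesis unfolding before_def by blast
  qed
  have inv: "\<exists>x\<in>W' k. \<exists>y\<in>W' k. p x < p y \<and> v y < v x" if "k < 2 * s" for k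
  proof -
    have k: "2 * k < 4 * s" using that by simp
    have "x (2 * k) \<in> W' k" "y (2 * k) \<in> W' k" using xy[OF k] unfolding W'_def by auto
    moreover have "v (y (2 * k)) < v (x (2 * k))" using z[OF k] by simp
    ultimately show ?thesis using xy[OF k] by blast
  qed
  have cell: "C i \<inter> W' l \<noteq> {}" if "i < a" "l < 2 * s" for i l
    using CW[of i "2 * l"] that unfolding W'_def by auto
  define A where "A = {z\<in>Z. \<forall>r\<in>R. p z < p r}"
  define B where "B = {z\<in>Z. \<forall>r\<in>R. p r < p z}"
  have CX: "C i \<subseteq> X" if "i < a" for i using CR[OF that] sub by blast
  have AX: "A \<subseteq> X" and BX: "B \<subseteq> X" using sub unfolding A_def B_def by auto
  have AC: "before p A (C i)" and CB: "before p (C i) B" if "i < a" for i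
    using CR[OF that] unfolding A_def B_def before_def by auto
  \<comment> \<open>The kept rows are split by the side of their separating point; one side gets at
    least half of the \<open>2 * s\<close> rows.\<close>
  define SA where "SA = {k\<in>{..<2 * s}. z (2 * k) \<in> A}"
  define SB where "SB = {k\<in>{..<2 * s}. z (2 * k) \<in> B}"
  have "Z \<subseteq> A \<union> B" using co unfolding A_def B_def coarse_def by blast
  moreover have "z (2 * k) \<in> Z" if "k < 2 * s" for k using z[of "2 * k"] that by simp
  ultimately have "SA \<union> SB = {..<2 * s}" unfolding SA_def SB_def by blast
  then have "2 * s \<le> card SA + card SB"
    by (metis card_Un_le card_lessThan)
  then consider "s \<le> card SA" | "s \<le> card SB" by linarith
  then show ?thesis
  proof cases
    case 1
    \<comment> \<open>The new column is leftmost and takes index 0, shifting the others; on the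
      other side it takes index \<open>a\<close>.\<close>
    show ?thesis
    proof (rule gridI[of SA s "Suc a" "\<lambda>i. case i of 0 \<Rightarrow> A | Suc i \<Rightarrow> C i" X W' p v])
      show "finite SA" unfolding SA_def by simp
      show "s \<le> card SA" by fact
      show "(case i of 0 \<Rightarrow> A | Suc i \<Rightarrow> C i) \<subseteq> X" if "i < Suc a" for i
        using that AX CX by (simp split: nat.splits)
      show "before p (case i of 0 \<Rightarrow> A | Suc i \<Rightarrow> C i) (case j of 0 \<Rightarrow> A | Suc i \<Rightarrow> C i)"
        if "i < j" "j < Suc a" for i j
        using that CC AC by (simp split: nat.splits)
      show "(case i of 0 \<Rightarrow> A | Suc i \<Rightarrow> C i) \<inter> W' l \<noteq> {}" if "i < Suc a" "l \<in> SA" for i l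
        using that cell[of "i - 1" l] by (auto simp: SA_def W'_def split: nat.splits)
    qed (use W'X W'W' inv in \<open>auto simp: SA_def\<close>)
  next
    case 2
    show ?thesis
    proof (rule gridI[of SB s "Suc a" "C(a := B)" X W' p v])
      show "finite SB" unfolding SB_def by simp
      show "s \<le> card SB" by fact
      show "(C(a := B)) i \<subseteq> X" if "i < Suc a" for i
        using that BX CX by simp
      show "before p ((C(a := B)) i) ((C(a := B)) j)"
        if "i < j" "j < Suc a" for i j
        using that CC CB by (cases "j = a") auto
      show "(C(a := B)) i \<inter> W' l \<noteq> {}" if "i < Suc a" "l \<in> SB" for i l
        using that cell[of i l] by (auto simp: SB_def W'_def)
    qed (use W'X W'W' inv in \<open>auto simp: SB_def\<close>)
  qed
qed

text \<open>All ties between \<open>A\<close> and \<open>B\<close> occur in a single gap, where the rows meeting \<open>A\<close> come weakly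
  before those meeting \<open>B\<close>; keeping only the rows before or after a threshold removes the ties.\<close>

lemma coarse_split:
  fixes S :: "nat set"
  assumes fin: "finite Z" "finite S" and co: "coarse p v R Z v'" and sub: "A \<subseteq> R" "B \<subseteq> R"
    and AB: "before v' A B" and WW: "\<And>k l. k \<in> S \<Longrightarrow> l \<in> S \<Longrightarrow> k < l \<Longrightarrow> before p (W k) (W l)"
  shows "\<exists>T\<subseteq>S. card S \<le> 2 * card T + 1 \<and> (\<forall>k\<in>T. \<forall>l\<in>T. before v (A \<inter> W k) (B \<inter> W l))"
proof -
  define bad where "bad = {k\<in>S. \<exists>a\<in>A \<inter> W k. \<exists>l\<in>S. \<exists>b\<in>B \<inter> W l. gap v Z a = gap v Z b}"
  have le: "gap v Z a \<le> gap v Z b" if "a \<in> A" "b \<in> B" for a b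
    using co that sub AB unfolding coarse_def before_def by (metis le_less order.refl subsetD)
  have pos: "p a < p b" if "a \<in> A" "b \<in> B" "gap v Z a = gap v Z b" for a b
    using co that sub AB unfolding coarse_def before_def by (metis less_irrefl_nat subsetD)
  have good: "\<forall>k\<in>T. \<forall>l\<in>T. before v (A \<inter> W k) (B \<inter> W l)"
    if "\<And>k l a b. k \<in> T \<Longrightarrow> l \<in> T \<Longrightarrow> a \<in> A \<inter> W k \<Longrightarrow> b \<in> B \<inter> W l \<Longrightarrow> gap v Z a \<noteq> gap v Z b" for T
    using that le gap_less_imp_less[OF fin(1)] unfolding before_def
    by (metis IntD1 le_neq_implies_less)
  show ?thesis
  proof (cases "bad = {}")
    case True
    then have "\<forall>k\<in>S. \<forall>l\<in>S. before v (A \<inter> W k) (B \<inter> W l)"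
      by (intro good) (auto simp: bad_def)
    then show ?thesis by (intro exI[of _ S]) auto
  next
    case False
    \<comment> \<open>The last row that holds a tied point of \<open>A\<close> is the threshold; it
      is dropped itself, hence the \<open>+ 1\<close> in the bound.\<close>
    define t where "t = Max bad"
    have fb: "finite bad" using fin(2) unfolding bad_def by simp
    have tb: "t \<in> bad" unfolding t_def using fb False by (rule Max_in)
    then obtain a0 l0 b0 where t: "t \<in> S" "a0 \<in> A \<inter> W t" "l0 \<in> S" "b0 \<in> B \<inter> W l0" "gap v Z a0 = gap v Z b0"
      unfolding bad_def by auto
    have up: "k \<notin> bad" if "t < k" for k
      using Max_ge[OF fb, of k] that unfolding t_def by auto
    let ?U = "{k\<in>S. t < k}" and ?D = "{k\<in>S. k < t}"
    have "\<forall>k\<in>?U. \<forall>l\<in>?U. before v (A \<inter> W k) (B \<inter> W l)"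
    proof (rule good, rule notI)
      fix k l a b assume kl: "k \<in> ?U" "l \<in> ?U" "a \<in> A \<inter> W k" "b \<in> B \<inter> W l" "gap v Z a = gap v Z b"
      then have "k \<in> bad" unfolding bad_def by blast
      then show False using up kl(1) by blast
    qed
    moreover have "\<forall>k\<in>?D. \<forall>l\<in>?D. before v (A \<inter> W k) (B \<inter> W l)"
    proof (rule good, rule notI)
      fix k l a b assume kl: "k \<in> ?D" "l \<in> ?D" "a \<in> A \<inter> W k" "b \<in> B \<inter> W l" "gap v Z a = gap v Z b"
      \<comment> \<open>All four gaps coincide, because \<open>a\<close> ties with \<open>b\<close>
        and \<open>a0\<close> with \<open>b0\<close>. So \<open>a0\<close> precedes \<open>b\<close>
        in position, although \<open>b\<close> lies in a row before row \<open>t\<close>.\<close>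
      have "gap v Z a0 \<le> gap v Z b" "gap v Z a \<le> gap v Z b0" using le[of a0 b] le[of a b0] kl t by auto
      then have "p a0 < p b" using pos[of a0 b] kl t by auto
      moreover have "p b < p a0" using WW[of l t] kl t unfolding before_def by auto
      ultimately show False by simp
    qed
    moreover have "card S = card ?U + card ?D + 1"
    proof -
      have "S = insert t (?U \<union> ?D)" using t(1) by auto
      moreover have "card (insert t (?U \<union> ?D)) = Suc (card (?U \<union> ?D))"
        using fin(2) by (intro card_insert_disjoint) auto
      moreover have "card (?U \<union> ?D) = card ?U + card ?D"
        using fin(2) by (intro card_Un_disjoint) auto
      ultimately show ?thesis by simp
    qed
    then have "card S \<le> 2 * card ?U + 1 \<or> card S \<le> 2 * card ?D + 1" by linarith
    ultimately show ?thesis by (metis (no_types, lifting) mem_Collect_eq subsetI)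
  qed
qed

text \<open>Columns that are ordered for \<open>v'\<close> may share a gap and then overlap for
  \<open>v\<close>. Separating each column from the union of the earlier ones with
  \<open>coarse_split\<close> roughly halves the rows, once per column. Inversions for
  \<open>v'\<close> join different gaps and so remain inversions for \<open>v\<close>.\<close>

lemma grid_coarse_positions:
  assumes fin: "finite Z" and sub: "R \<subseteq> X"
    and co: "coarse p v R Z v'" and gr: "grid b (2 ^ b * Suc t) v' p R"
  shows "grid b t v p X"
proof -
  define s where "s = 2 ^ b * Suc t"
  obtain C W where CR: "\<And>i. i < b \<Longrightarrow> C i \<subseteq> R" and WR: "\<And>l. l < s \<Longrightarrow> W l \<subseteq> R"
    and CC: "\<And>i j. i < j \<Longrightarrow> j < b \<Longrightarrow> before v' (C i) (C j)"
    and WW: "\<And>k l. k < l \<Longrightarrow> l < s \<Longrightarrow> before p (W k) (W l)"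
    and CW: "\<And>i l. i < b \<Longrightarrow> l < s \<Longrightarrow> C i \<inter> W l \<noteq> {}"
    and inv: "\<And>l. l < s \<Longrightarrow> \<exists>x\<in>W l. \<exists>y\<in>W l. v' x < v' y \<and> p y < p x"
    by (rule gridE[OF gr[folded s_def]]) (rule that; assumption)
  \<comment> \<open>Counting rows plus one turns the loss
    \<open>card T \<le> 2 * card T' + 1\<close> into a clean factor 2.\<close>
  have "\<exists>T\<subseteq>{..<s}. Suc s \<le> 2 ^ i * Suc (card T) \<and>
      (\<forall>j<i. \<forall>i'<j. \<forall>k\<in>T. \<forall>l\<in>T. before v (C i' \<inter> W k) (C j \<inter> W l))" if "i \<le> b" for i
    using that
  proof (induction i)
    case 0
    show ?case by (intro exI[of _ "{..<s}"]) auto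
  next
    case (Suc i)
    then obtain T where T: "T \<subseteq> {..<s}" "Suc s \<le> 2 ^ i * Suc (card T)"
      "\<And>i' j k l. j < i \<Longrightarrow> i' < j \<Longrightarrow> k \<in> T \<Longrightarrow> l \<in> T \<Longrightarrow> before v (C i' \<inter> W k) (C j \<inter> W l)" by auto
    have "\<exists>T'\<subseteq>T. card T \<le> 2 * card T' + 1 \<and>
        (\<forall>k\<in>T'. \<forall>l\<in>T'. before v ((\<Union>j<i. C j) \<inter> W k) (C i \<inter> W l))"
    proof (rule coarse_split[OF fin _ co])
      show "finite T" using T(1) finite_subset by blast
      show "(\<Union>j<i. C j) \<subseteq> R" using CR Suc.prems by (intro UN_least) simp
      show "C i \<subseteq> R" using CR Suc.prems by simp
      show "before v' (\<Union>j<i. C j) (C i)" using CC[of _ i] Suc.prems unfolding before_def by auto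
      show "before p (W k) (W l)" if "k \<in> T" "l \<in> T" "k < l" for k l using WW that T(1) by auto
    qed
    then obtain T' where T': "T' \<subseteq> T" "card T \<le> 2 * card T' + 1"
      "\<And>k l. k \<in> T' \<Longrightarrow> l \<in> T' \<Longrightarrow> before v ((\<Union>j<i. C j) \<inter> W k) (C i \<inter> W l)" by blast
    have "Suc s \<le> 2 ^ i * (2 * Suc (card T'))"
      by (rule le_trans[OF T(2)], rule mult_le_mono2) (use T'(2) in simp)
    moreover have "before v (C i' \<inter> W k) (C j \<inter> W l)"
      if "j < Suc i" "i' < j" "k \<in> T'" "l \<in> T'" for i' j k l
    proof (cases "j = i")
      case True
      then show ?thesis using T'(3)[OF that(3,4)] that(2) unfolding before_def by auto
    next
      case False
      then show ?thesis using T(3)[of j i' k l] that T'(1) by auto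
    qed
    ultimately show ?case using T(1) T'(1) by (intro exI[of _ T']) auto
  qed
  from this[OF order.refl] obtain T where T: "T \<subseteq> {..<s}" "Suc s \<le> 2 ^ b * Suc (card T)"
      "\<forall>j<b. \<forall>i'<j. \<forall>k\<in>T. \<forall>l\<in>T. before v (C i' \<inter> W k) (C j \<inter> W l)"
    by (elim exE conjE) (rule that)
  have "2 ^ b * Suc t < 2 ^ b * Suc (card T)" using T(2) unfolding s_def by linarith
  then have card: "t \<le> card T" by simp
  \<comment> \<open>Columns are trimmed to the surviving rows, since they are separated only
    there.\<close>
  show ?thesis
  proof (rule gridI[of T t b "\<lambda>i. C i \<inter> (\<Union>l\<in>T. W l)" X W v p])
    show "finite T" using T(1) finite_subset by blast
    show "\<exists>x\<in>W l. \<exists>y\<in>W l. v x < v y \<and> p y < p x" if l: "l \<in> T" for l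
    proof -
      obtain x y where xy: "x \<in> W l" "y \<in> W l" "v' x < v' y" "p y < p x"
        using inv[of l] l T(1) by auto
      have "x \<in> R" "y \<in> R" using xy WR[of l] l T(1) by auto
      then have "gap v Z x < gap v Z y" using co xy unfolding coarse_def by (meson order_less_asym)
      then show ?thesis using xy gap_less_imp_less[OF fin] by blast
    qed
    show "before v (C i \<inter> (\<Union>l\<in>T. W l)) (C j \<inter> (\<Union>l\<in>T. W l))" if "i < j" "j < b" for i j
      using T(3) that unfolding before_def by blast
    show "C i \<inter> (\<Union>l\<in>T. W l) \<inter> W l \<noteq> {}" if "i < b" "l \<in> T" for i l
      using CW[of i l] that T(1) by blast
    show "t \<le> card T" by fact
    show "C i \<inter> (\<Union>l\<in>T. W l) \<subseteq> X" if "i < b" for i using CR[OF that] sub by blast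
    show "W l \<subseteq> X" if "l \<in> T" for l using WR[of l] that T(1) sub by blast
    show "before p (W k) (W l)" if "k \<in> T" "l \<in> T" "k < l" for k l using WW that T(1) by blast
  qed
qed

text \<open>Cut greedily at the lowest value \<open>v x\<close> that is the upper end of an
  inversion. There is no inversion among the points below, \<open>x\<close> takes a colour of its
  own, and above it one disjoint inversion fewer fits: two colours per inversion.\<close>

lemma rearr_no_inversion_rows:
  assumes "finite X" "inj_on p X" "inj_on v X" "\<not> grid 0 s p v X" "2 * s \<le> 2 ^ e"
  shows "rearr (4 * e) p v X"
proof -
  have "\<exists>c::'a \<Rightarrow> nat. (\<forall>x\<in>X. c x < 2 * s) \<and>
      (\<forall>x\<in>X. \<forall>y\<in>X. c x = c y \<longrightarrow> p x < p y \<longrightarrow> v x < v y)"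
    using assms(1,3,4)
  proof (induction s arbitrary: X)
    case 0
    \<comment> \<open>A grid without rows always exists, contrary to the hypothesis.\<close>
    then show ?case by (simp add: grid_def)
  next
    case (Suc s)
    let ?inv = "\<lambda>x. x \<in> X \<and> (\<exists>y\<in>X. p x < p y \<and> v y < v x)"
    show ?case
    proof (cases "\<exists>x. ?inv x")
      case False
      then have "v x < v y" if "x \<in> X" "y \<in> X" "p x < p y" for x y
        using that Suc.prems(2) by (metis inj_onD less_irrefl_nat linorder_neqE_nat)
      then show ?thesis by (intro exI[of _ "\<lambda>_. 0"]) auto
    next
      case True
      then obtain x where "?inv x" and min: "\<And>x'. ?inv x' \<Longrightarrow> v x \<le> v x'"
        using ex_has_least_nat[of ?inv _ v] by blast
      then obtain y where xy: "x \<in> X" "y \<in> X" "p x < p y" "v y < v x" by blast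
      let ?X = "{w\<in>X. v x < v w}"
      have "\<not> grid 0 s p v ?X"
      proof
        assume g: "grid 0 s p v ?X"
        obtain W where W: "\<And>l. l < s \<Longrightarrow> W l \<subseteq> ?X"
          "\<And>k l. k < l \<Longrightarrow> l < s \<Longrightarrow> before v (W k) (W l)"
          "\<And>l. l < s \<Longrightarrow> \<exists>x\<in>W l. \<exists>y\<in>W l. p x < p y \<and> v y < v x"
          by (rule gridE[OF g]) (rule that; assumption)
        define W' where "W' l = (case l of 0 \<Rightarrow> {x, y} | Suc l \<Rightarrow> W l)" for l
        have "grid 0 (Suc s) p v X"
        proof (rule gridI[of "{..<Suc s}" _ _ _ _ W'])
          show "W' l \<subseteq> X" if "l \<in> {..<Suc s}" for l
            using that xy W(1) unfolding W'_def by (auto split: nat.splits)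
          show "before v (W' k) (W' l)" if kl: "k \<in> {..<Suc s}" "l \<in> {..<Suc s}" "k < l" for k l
          proof -
            obtain l' where l': "l = Suc l'" "l' < s" using kl by (cases l) auto
            show ?thesis
            proof (cases k)
              case 0
              then show ?thesis using W(1)[OF l'(2)] xy l'(1) unfolding W'_def before_def by auto
            next
              case (Suc k')
              then show ?thesis using W(2)[of k' l'] kl l' unfolding W'_def by auto
            qed
          qed
          show "\<exists>x\<in>W' l. \<exists>y\<in>W' l. p x < p y \<and> v y < v x" if "l \<in> {..<Suc s}" for l
            using that xy W(3) unfolding W'_def by (auto split: nat.splits)
        qed auto
        then show False using Suc.prems(3) by blast
      qed
      moreover have "finite ?X" "inj_on v ?X" using Suc.prems by (auto simp: inj_on_def)
      ultimately obtain c where c: "\<forall>x\<in>?X. c x < 2 * s"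
        "\<forall>x\<in>?X. \<forall>y\<in>?X. c x = c y \<longrightarrow> p x < p y \<longrightarrow> v x < v y"
        using Suc.IH[of ?X] by blast
      \<comment> \<open>The two new colours are \<open>2 * s\<close> for the points below
        \<open>x\<close> and \<open>2 * s + 1\<close> for \<open>x\<close> itself.\<close>
      define c' where "c' w = (if v x < v w then c w else if v w = v x then 2 * s + 1 else 2 * s)" for w
      have "c' w < 2 * Suc s" if "w \<in> X" for w
        using c(1) that unfolding c'_def by (auto simp: less_Suc_eq)
      moreover have "v w < v w'" if w: "w \<in> X" "w' \<in> X" "c' w = c' w'" "p w < p w'" for w w'
      proof -
        have ne: "v w \<noteq> v w'" using w Suc.prems(2) by (auto dest: inj_onD)
        consider "v x < v w" "v x < v w'" | "v w = v x" "v w' = v x" | "v w < v x" "v w' < v x"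
          using c(1) w unfolding c'_def by (force split: if_splits)
        then show ?thesis
        proof cases
          case 1
          then show ?thesis using c(2) w unfolding c'_def by auto
        next
          case 2
          then show ?thesis using ne by simp
        next
          case 3
          show ?thesis
          proof (rule ccontr)
            assume "\<not> v w < v w'"
            then have "?inv w" using w ne by (auto intro!: bexI[of _ w'])
            then show False using min 3 by fastforce
          qed
        qed
      qed
      ultimately show ?thesis by blast
    qed
  qed
  then obtain c :: "'a \<Rightarrow> nat" where c: "\<forall>x\<in>X. c x < 2 * s"
    "\<forall>x\<in>X. \<forall>y\<in>X. c x = c y \<longrightarrow> p x < p y \<longrightarrow> v x < v y" by blast
  show ?thesis
    by (rule rearr_colour[of X c]) (use c assms in \<open>force+\<close>)
qed

section \<open>Reduction to coarser rearrangements\<close>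

lemma gap_less:
  assumes "finite Z" "w \<in> Z" "f x \<le> f w" "f w < f y"
  shows "gap f Z x < gap f Z y"
  unfolding gap_def
proof (rule psubset_card_mono)
  have "{z\<in>Z. f z < f x} \<subseteq> {z\<in>Z. f z < f y}" using assms(3,4) by auto
  moreover have "w \<in> {z\<in>Z. f z < f y}" "w \<notin> {z\<in>Z. f z < f x}" using assms by auto
  ultimately show "{z\<in>Z. f z < f x} \<subset> {z\<in>Z. f z < f y}" by blast
qed (use assms(1) in simp)

section \<open>Lexicographic orders, blocks and runs\<close>

lemma lex_exists:
  fixes f g :: "'a \<Rightarrow> nat"
  assumes "finite J"
  shows "\<exists>q::'a \<Rightarrow> nat. \<forall>x\<in>J. \<forall>y\<in>J. (q x < q y \<longleftrightarrow> f x < f y \<or> f x = f y \<and> g x < g y) \<and>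
    (q x = q y \<longleftrightarrow> f x = f y \<and> g x = g y)"
proof -
  obtain M where M: "\<forall>x\<in>J. g x < M"
    using assms finite_nat_set_iff_bounded[of "g ` J"] by auto
  have less: "f x * M + g x < f y * M + g y" if "x \<in> J" "f x < f y" for x y
  proof -
    have "f x * M + g x < Suc (f x) * M" using M that by simp
    also have "\<dots> \<le> f y * M" using that by (intro mult_le_mono1) simp
    finally show ?thesis by simp
  qed
  \<comment> \<open>The pair is encoded in base \<open>M\<close> with last digit
    \<open>g x\<close>.\<close>
  show ?thesis
  proof (rule exI[of _ "\<lambda>x. f x * M + g x"], intro ballI)
    fix x y assume "x \<in> J" "y \<in> J"
    then show "(f x * M + g x < f y * M + g y \<longleftrightarrow> f x < f y \<or> f x = f y \<and> g x < g y) \<and>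
        (f x * M + g x = f y * M + g y \<longleftrightarrow> f x = f y \<and> g x = g y)"
      using less[of x y] less[of y x] by (cases "f x" "f y" rule: linorder_cases) auto
  qed
qed

text \<open>If the representatives were ordered the other way, then \<open>\<kappa> y\<close> would
  lie between two members of the block of \<open>x\<close>, or \<open>x\<close> between two members
  of the block of \<open>y\<close>; but blocks are intervals for \<open>f\<close>.\<close>

lemma block_order:
  fixes f :: "'a \<Rightarrow> nat"
  assumes inj: "inj_on f J" and cl: "\<forall>x\<in>J. \<kappa> x \<in> J \<and> \<kappa> (\<kappa> x) = \<kappa> x"
    and conv: "\<forall>x\<in>J. \<forall>y\<in>J. \<forall>w\<in>J. \<kappa> x = \<kappa> y \<longrightarrow> f x < f w \<longrightarrow> f w < f y \<longrightarrow> \<kappa> w = \<kappa> x"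
    and xy: "x \<in> J" "y \<in> J" "\<kappa> x \<noteq> \<kappa> y"
  shows "f x < f y \<longleftrightarrow> f (\<kappa> x) < f (\<kappa> y)"
proof -
  have *: "f (\<kappa> x) < f (\<kappa> y)" if "x \<in> J" "y \<in> J" "\<kappa> x \<noteq> \<kappa> y" "f x < f y" for x y
  proof (rule ccontr)
    assume "\<not> ?thesis"
    moreover have "f (\<kappa> x) \<noteq> f (\<kappa> y)" using cl that inj by (auto dest: inj_onD)
    ultimately have less: "f (\<kappa> y) < f (\<kappa> x)" by simp
    have "\<kappa> y \<noteq> x" using cl that by metis
    then have "f (\<kappa> y) \<noteq> f x" using cl that inj by (auto dest: inj_onD)
    then consider "f x < f (\<kappa> y)" | "f (\<kappa> y) < f x" by linarith
    then show False
    proof cases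
      case 1
      then show False using conv cl that less by metis
    next
      case 2
      then show False using conv cl that by metis
    qed
  qed
  have "f x \<noteq> f y" using xy inj by (auto dest: inj_onD)
  then show ?thesis using *[of x y] *[of y x] xy by (metis less_asym linorder_neqE_nat)
qed

text \<open>The runs are the classes of \<open>E\<close>, which relates two points if
  \<open>g\<close> is constant on the positions between them. Two runs with the same
  \<open>g\<close> must therefore be interrupted by another value of \<open>g\<close>.\<close>

lemma runs_exist:
  fixes p g :: "'a \<Rightarrow> nat"
  assumes inj: "inj_on p J"
  obtains \<kappa> where "\<And>x. x \<in> J \<Longrightarrow> \<kappa> x \<in> J \<and> \<kappa> (\<kappa> x) = \<kappa> x"
    "\<And>x y w. x \<in> J \<Longrightarrow> y \<in> J \<Longrightarrow> w \<in> J \<Longrightarrow> \<kappa> x = \<kappa> y \<Longrightarrow> p x < p w \<Longrightarrow> p w < p y \<Longrightarrow> \<kappa> w = \<kappa> x"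
    "\<And>x y. x \<in> J \<Longrightarrow> y \<in> J \<Longrightarrow> \<kappa> x = \<kappa> y \<Longrightarrow> g x = g y"
    "\<And>x y. x \<in> J \<Longrightarrow> y \<in> J \<Longrightarrow> \<kappa> x \<noteq> \<kappa> y \<Longrightarrow> g x = g y \<Longrightarrow> p x < p y \<Longrightarrow>
      \<exists>w\<in>J. g w \<noteq> g x \<and> p x < p w \<and> p w < p y"
proof -
  define E where "E x y \<longleftrightarrow>
    (\<forall>w\<in>J. (p x \<le> p w \<and> p w \<le> p y) \<or> (p y \<le> p w \<and> p w \<le> p x) \<longrightarrow> g w = g x)" for x y
  have Eg: "g x = g y" if "E x y" "y \<in> J" for x y
    using that unfolding E_def by (metis le_cases order.refl)
  have Erefl: "E x x" if "x \<in> J" for x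
    using inj that unfolding E_def by (metis inj_onD le_antisym)
  have Esym: "E y x" if "E x y" "x \<in> J" "y \<in> J" for x y
    using that Eg[OF that(1,3)] unfolding E_def by metis
  have Etrans: "E x z" if "E x y" "E y z" "x \<in> J" "y \<in> J" "z \<in> J" for x y z
  proof -
    have "g w = g x" if w: "w \<in> J" "(p x \<le> p w \<and> p w \<le> p z) \<or> (p z \<le> p w \<and> p w \<le> p x)" for w
    proof -
      have "((p x \<le> p w \<and> p w \<le> p y) \<or> (p y \<le> p w \<and> p w \<le> p x)) \<or>
        ((p y \<le> p w \<and> p w \<le> p z) \<or> (p z \<le> p w \<and> p w \<le> p y))" using w(2) by linarith
      then show ?thesis using that Eg[OF \<open>E x y\<close> \<open>y \<in> J\<close>] \<open>E x y\<close> \<open>E y z\<close> w(1) unfolding E_def by metis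
    qed
    then show ?thesis unfolding E_def by blast
  qed
  define \<kappa> where "\<kappa> x = (SOME y. y \<in> J \<and> E x y)" for x
  have \<kappa>: "\<kappa> x \<in> J \<and> E x (\<kappa> x)" if "x \<in> J" for x
    unfolding \<kappa>_def by (rule someI[of _ x]) (use that Erefl in simp)
  have \<kappa>_eq: "\<kappa> x = \<kappa> y \<longleftrightarrow> E x y" if "x \<in> J" "y \<in> J" for x y
  proof
    assume "\<kappa> x = \<kappa> y"
    then show "E x y" using \<kappa>[OF that(1)] \<kappa>[OF that(2)] Esym Etrans that by metis
  next
    assume "E x y"
    \<comment> \<open>Equivalent points have the same candidates as representative, so the choice
      operator picks the same one.\<close>
    then have "(\<lambda>z. z \<in> J \<and> E x z) = (\<lambda>z. z \<in> J \<and> E y z)"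
      using that Esym Etrans by blast
    then show "\<kappa> x = \<kappa> y" unfolding \<kappa>_def by simp
  qed
  show ?thesis
  proof (rule that[of \<kappa>])
    show "\<kappa> x \<in> J \<and> \<kappa> (\<kappa> x) = \<kappa> x" if "x \<in> J" for x
      using \<kappa>[OF that] \<kappa>_eq Esym that by metis
    show "\<kappa> w = \<kappa> x" if "x \<in> J" "y \<in> J" "w \<in> J" "\<kappa> x = \<kappa> y" "p x < p w" "p w < p y" for x y w
    proof -
      have "E x y" using that \<kappa>_eq by blast
      then have "E x w" using that(5,6) unfolding E_def by (metis le_less_trans less_asym less_imp_le order.trans not_less)
      then show ?thesis using \<kappa>_eq that by metis
    qed
    show "g x = g y" if "x \<in> J" "y \<in> J" "\<kappa> x = \<kappa> y" for x y
      using that \<kappa>_eq Eg by blast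
    show "\<exists>w\<in>J. g w \<noteq> g x \<and> p x < p w \<and> p w < p y"
      if xy: "x \<in> J" "y \<in> J" "\<kappa> x \<noteq> \<kappa> y" "g x = g y" "p x < p y" for x y
    proof -
      have "\<not> E x y" using \<kappa>_eq xy by blast
      then obtain w where w: "w \<in> J" "p x \<le> p w" "p w \<le> p y" "g w \<noteq> g x"
        using xy(5) unfolding E_def by (metis le_trans not_less)
      moreover have "p w \<noteq> p x" "p w \<noteq> p y" using w xy inj by (auto dest: inj_onD)
      ultimately show ?thesis by force
    qed
  qed
qed

text \<open>The order \<open>q\<close> sorts the runs \<open>K\<close> of \<open>J\<close> by their gap and each run by induction, relative to
  \<open>J - K\<close>. Then the points of a run in one gap of \<open>J - K\<close> are contiguous both for \<open>q\<close> and, among the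
  points of \<open>J\<close> in one gap of \<open>Z\<close>, for \<open>v\<close>. A piece in a single gap of \<open>Z\<close> has only one run;
  it is cut into two parts instead, which are merged with two colours.\<close>

lemma refinement_exists:
  fixes p v :: "'a \<Rightarrow> nat"
  assumes fin: "finite X" and inj: "inj_on p X" "inj_on v X"
    and tau: "\<And>R Z v'. R \<subseteq> X \<Longrightarrow> Z \<subseteq> X \<Longrightarrow> coarse p v R Z v' \<Longrightarrow> rearr M p v' R"
    and mu: "\<And>R Z p'. R \<subseteq> X \<Longrightarrow> Z \<subseteq> X \<Longrightarrow> coarse v p R Z p' \<Longrightarrow> rearr N p' v R"
    and N: "4 \<le> N"
  shows "J \<subseteq> X \<Longrightarrow> Z \<subseteq> X \<Longrightarrow> \<forall>z\<in>Z. (\<forall>r\<in>J. p z < p r) \<or> (\<forall>r\<in>J. p r < p z) \<Longrightarrow>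
    \<exists>q. inj_on q J \<and> rearr M p q J \<and> (\<forall>x\<in>J. \<forall>y\<in>J. gap v Z x < gap v Z y \<longrightarrow> q x < q y) \<and>
      (\<forall>\<gamma>. rearr N q v {x\<in>J. gap v Z x = \<gamma>})"
proof (induction "card J" arbitrary: J Z rule: less_induct)
  case less
  have finJ: "finite J" and finZ: "finite Z" and injJ: "inj_on p J" "inj_on v J"
    using less.prems fin inj by (auto intro: finite_subset inj_on_subset)
  let ?g = "gap v Z"
  show ?case
  proof (cases "\<exists>a b. a \<in> J \<and> b \<in> J \<and> a \<noteq> b")
    case False
    have "rearr n q w S" if "S \<subseteq> J" for n q and w :: "'a \<Rightarrow> nat" and S
      by (rule rearr_refl) (use that False in \<open>metis less_irrefl_nat subsetD\<close>)
    moreover have "p x < p y" if "x \<in> J" "y \<in> J" "?g x < ?g y" for x y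
      using that False by (metis less_irrefl_nat)
    ultimately show ?thesis using injJ(1) by (intro exI[of _ p]) simp
  next
    case True
    \<comment> \<open>Blocks are intervals of positions inside one gap, and there are at least two,
      so the induction applies to each. The final disjunction is what later allows merging blocks of
      one gap: points of other gaps separate them, or there are at most two blocks.\<close>
    have "\<exists>\<kappa>. (\<forall>x\<in>J. \<kappa> x \<in> J \<and> \<kappa> (\<kappa> x) = \<kappa> x) \<and>
      (\<forall>x\<in>J. \<forall>y\<in>J. \<forall>w\<in>J. \<kappa> x = \<kappa> y \<longrightarrow> p x < p w \<longrightarrow> p w < p y \<longrightarrow> \<kappa> w = \<kappa> x) \<and>
      (\<forall>x\<in>J. \<forall>y\<in>J. \<kappa> x = \<kappa> y \<longrightarrow> ?g x = ?g y) \<and>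
      (\<exists>x\<in>J. \<exists>y\<in>J. \<kappa> x \<noteq> \<kappa> y) \<and>
      ((\<forall>x\<in>J. \<forall>y\<in>J. \<kappa> x \<noteq> \<kappa> y \<longrightarrow> ?g x = ?g y \<longrightarrow> p x < p y \<longrightarrow>
          (\<exists>w\<in>J. ?g w \<noteq> ?g x \<and> p x < p w \<and> p w < p y)) \<or>
        (\<exists>a b. \<forall>x\<in>J. \<kappa> x = a \<or> \<kappa> x = b))"
    proof (cases "\<exists>x\<in>J. \<exists>y\<in>J. ?g x \<noteq> ?g y")
      case nonconst: True
      show ?thesis
      proof (rule runs_exist[OF injJ(1), of ?g], goal_cases)
        case (1 \<kappa>)
        have "\<exists>x\<in>J. \<exists>y\<in>J. \<kappa> x \<noteq> \<kappa> y" using nonconst 1(3) by blast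
        then show ?case
          by (intro exI[of _ \<kappa>] conjI disjI1 ballI impI)
            (erule 1(1)[THEN conjunct1] | erule 1(1)[THEN conjunct2] | assumption | erule (5) 1(2) | erule (2) 1(3) | erule (4) 1(4))+
      qed
    next
      \<comment> \<open>Cutting off the leftmost point \<open>a\<close> leaves an interval;
        \<open>b\<close> is merely its label.\<close>
      case const: False
      obtain a where a: "a \<in> J" "\<And>y. y \<in> J \<Longrightarrow> p a \<le> p y"
        using True ex_has_least_nat[of "\<lambda>x. x \<in> J" _ p] by metis
      obtain b where b: "b \<in> J" "b \<noteq> a" using True by metis
      define \<kappa> where "\<kappa> x = (if x = a then a else b)" for x
      have \<kappa>: "\<kappa> x = a \<longleftrightarrow> x = a" "\<kappa> x = a \<or> \<kappa> x = b" for x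
        using b(2) unfolding \<kappa>_def by auto
      show ?thesis
      proof (intro exI[of _ \<kappa>] conjI)
        show "\<forall>x\<in>J. \<kappa> x \<in> J \<and> \<kappa> (\<kappa> x) = \<kappa> x" using a(1) b unfolding \<kappa>_def by simp
        show "\<forall>x\<in>J. \<forall>y\<in>J. \<forall>w\<in>J. \<kappa> x = \<kappa> y \<longrightarrow> p x < p w \<longrightarrow> p w < p y \<longrightarrow> \<kappa> w = \<kappa> x"
        proof (intro ballI impI)
          fix x y w assume xyw: "x \<in> J" "y \<in> J" "w \<in> J" "\<kappa> x = \<kappa> y" "p x < p w" "p w < p y"
          then have "w \<noteq> a" "y \<noteq> a" using a(2)[of x] a(2)[of w] by auto
          then show "\<kappa> w = \<kappa> x" using \<kappa> xyw(4) by metis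
        qed
        show "\<forall>x\<in>J. \<forall>y\<in>J. \<kappa> x = \<kappa> y \<longrightarrow> ?g x = ?g y" using const by blast
        show "\<exists>x\<in>J. \<exists>y\<in>J. \<kappa> x \<noteq> \<kappa> y" using a(1) b \<kappa> by metis
      qed (use \<kappa>(2) in blast)
    qed
    then obtain \<kappa> where \<kappa>': "\<forall>x\<in>J. \<kappa> x \<in> J \<and> \<kappa> (\<kappa> x) = \<kappa> x"
      and conv': "\<forall>x\<in>J. \<forall>y\<in>J. \<forall>w\<in>J. \<kappa> x = \<kappa> y \<longrightarrow> p x < p w \<longrightarrow> p w < p y \<longrightarrow> \<kappa> w = \<kappa> x"
      and \<kappa>g': "\<forall>x\<in>J. \<forall>y\<in>J. \<kappa> x = \<kappa> y \<longrightarrow> ?g x = ?g y"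
      and split: "\<exists>x\<in>J. \<exists>y\<in>J. \<kappa> x \<noteq> \<kappa> y"
      and alt: "(\<forall>x\<in>J. \<forall>y\<in>J. \<kappa> x \<noteq> \<kappa> y \<longrightarrow> ?g x = ?g y \<longrightarrow> p x < p y \<longrightarrow>
          (\<exists>w\<in>J. ?g w \<noteq> ?g x \<and> p x < p w \<and> p w < p y)) \<or> (\<exists>a b. \<forall>x\<in>J. \<kappa> x = a \<or> \<kappa> x = b)"
      by (elim exE conjE) (rule that)
    have \<kappa>: "\<kappa> x \<in> J \<and> \<kappa> (\<kappa> x) = \<kappa> x" if "x \<in> J" for x
      using \<kappa>' that by blast
    have conv: "\<kappa> w = \<kappa> x"
      if "x \<in> J" "y \<in> J" "w \<in> J" "\<kappa> x = \<kappa> y" "p x < p w" "p w < p y" for x y w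
      using conv' that by blast
    have \<kappa>g: "?g x = ?g y" if "x \<in> J" "y \<in> J" "\<kappa> x = \<kappa> y" for x y
      using \<kappa>g' that by blast
    note border = block_order[OF injJ(1) \<kappa>' conv']
    define K where "K c = {x\<in>J. \<kappa> x = c}" for c
    define h where "h c = gap v (J - K c)" for c
    have h_less: "v x < v y" if "h c x < h c y" for c x y
      using gap_less_imp_less[of "J - K c" v x y] that finJ unfolding h_def by simp
    \<comment> \<open>A block plays the role of \<open>J\<close> and the rest of \<open>J\<close>
      that of \<open>Z\<close>: as the block is an interval, every other point lies left or right of
      it.\<close>
    have "\<exists>q. inj_on q (K c) \<and> rearr M p q (K c) \<and>
        (\<forall>x\<in>K c. \<forall>y\<in>K c. h c x < h c y \<longrightarrow> q x < q y) \<and>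
        (\<forall>\<gamma>. rearr N q v {x\<in>K c. h c x = \<gamma>})" for c
      unfolding h_def
    proof (rule less.hyps)
      obtain x where "x \<in> J" "\<kappa> x \<noteq> c" using split by metis
      then have "K c \<subset> J" unfolding K_def by blast
      then show "card (K c) < card J" by (rule psubset_card_mono[OF finJ])
      show "K c \<subseteq> X" "J - K c \<subseteq> X" using less.prems(1) unfolding K_def by auto
      show "\<forall>z\<in>J - K c. (\<forall>r\<in>K c. p z < p r) \<or> (\<forall>r\<in>K c. p r < p z)"
      proof (intro ballI, rule ccontr)
        fix z assume z: "z \<in> J - K c" "\<not> ((\<forall>r\<in>K c. p z < p r) \<or> (\<forall>r\<in>K c. p r < p z))"
        then obtain r r' where r: "r \<in> K c" "r' \<in> K c" "\<not> p z < p r" "\<not> p r' < p z" by blast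
        have "p z \<noteq> p r" "p z \<noteq> p r'" using z(1) r injJ(1) unfolding K_def by (auto dest: inj_onD)
        then show False using conv[of r r' z] z(1) r unfolding K_def by force
      qed
    qed
    then obtain Q where Q_inj: "\<And>c. inj_on (Q c) (K c)" and Q_pos: "\<And>c. rearr M p (Q c) (K c)"
      and Q_gap: "\<And>c x y. x \<in> K c \<Longrightarrow> y \<in> K c \<Longrightarrow> h c x < h c y \<Longrightarrow> Q c x < Q c y"
      and Q_val: "\<And>c \<gamma>. rearr N (Q c) v {x\<in>K c. h c x = \<gamma>}"
      by metis
    \<comment> \<open>\<open>m\<close> orders blocks by gap and then by position; \<open>q\<close>
      refines it by the inductive order inside each block.\<close>
    obtain m :: "'a \<Rightarrow> nat" where m: "\<forall>x\<in>J. \<forall>y\<in>J.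
        (m x < m y \<longleftrightarrow> ?g x < ?g y \<or> ?g x = ?g y \<and> p (\<kappa> x) < p (\<kappa> y)) \<and>
        (m x = m y \<longleftrightarrow> ?g x = ?g y \<and> p (\<kappa> x) = p (\<kappa> y))"
      using lex_exists[OF finJ, of ?g "\<lambda>x. p (\<kappa> x)"] by blast
    obtain q :: "'a \<Rightarrow> nat" where q: "\<forall>x\<in>J. \<forall>y\<in>J.
        (q x < q y \<longleftrightarrow> m x < m y \<or> m x = m y \<and> Q (\<kappa> x) x < Q (\<kappa> y) y) \<and>
        (q x = q y \<longleftrightarrow> m x = m y \<and> Q (\<kappa> x) x = Q (\<kappa> y) y)"
      using lex_exists[OF finJ, of m "\<lambda>x. Q (\<kappa> x) x"] by blast
    have p\<kappa>: "p (\<kappa> x) = p (\<kappa> y) \<longleftrightarrow> \<kappa> x = \<kappa> y" if "x \<in> J" "y \<in> J" for x y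
      using that \<kappa> injJ(1) by (metis inj_onD)
    have m_eq: "m x = m y \<longleftrightarrow> \<kappa> x = \<kappa> y" if "x \<in> J" "y \<in> J" for x y
      using m that p\<kappa>[OF that] \<kappa>g[OF that] by auto
    have q_same: "q x < q y \<longleftrightarrow> Q (\<kappa> x) x < Q (\<kappa> x) y" if "x \<in> J" "y \<in> J" "\<kappa> x = \<kappa> y" for x y
      using q that m_eq[OF that(1,2)] by auto
    have q_diff: "q x < q y \<longleftrightarrow> ?g x < ?g y \<or> ?g x = ?g y \<and> p (\<kappa> x) < p (\<kappa> y)"
      if "x \<in> J" "y \<in> J" "\<kappa> x \<noteq> \<kappa> y" for x y
      using q m that m_eq[OF that(1,2)] by auto
    have q_inj: "inj_on q J"
    proof (rule inj_onI)
      fix x y assume xy: "x \<in> J" "y \<in> J" "q x = q y"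
      then have "\<kappa> x = \<kappa> y" "Q (\<kappa> x) x = Q (\<kappa> y) y" using q m_eq[of x y] by auto
      then show "x = y" using xy Q_inj[of "\<kappa> x"] unfolding K_def by (auto dest: inj_onD)
    qed
    have g\<kappa>: "?g (\<kappa> x) = ?g x" if "x \<in> J" for x using \<kappa> \<kappa>g that by metis
    \<comment> \<open>On the labels, \<open>m\<close> is coarse with respect to \<open>Z\<close>, so
      \<open>tau\<close> moves the blocks while the induction rearranges their contents.\<close>
    have pos: "rearr M p q J"
    proof (rule rearr_subst[of J p q p \<kappa> m M])
      have sub: "\<kappa> ` J \<subseteq> J" using \<kappa> by auto
      show "inj_on p (\<kappa> ` J)" using injJ(1) sub by (rule inj_on_subset)
      show "inj_on m (\<kappa> ` J)" using m_eq \<kappa> by (auto simp: inj_on_def)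
      show "rearr M p m (\<kappa> ` J)"
      proof (rule tau[of _ Z])
        show "\<kappa> ` J \<subseteq> X" using sub less.prems(1) by blast
        show "coarse p v (\<kappa> ` J) Z m"
          unfolding coarse_def
        proof (intro conjI)
          show "\<forall>z\<in>Z. (\<forall>r\<in>\<kappa> ` J. p z < p r) \<or> (\<forall>r\<in>\<kappa> ` J. p r < p z)"
            using less.prems(3) sub by blast
          show "\<forall>x\<in>\<kappa> ` J. \<forall>y\<in>\<kappa> ` J.
              m x < m y \<longleftrightarrow> ?g x < ?g y \<or> ?g x = ?g y \<and> p x < p y"
            using \<kappa> m by simp
        qed
      qed (rule less.prems(2))
      show "rearr M p q {x\<in>J. \<kappa> x = c}" for c
      proof -
        have "rearr M p (Q c) {x\<in>J. \<kappa> x = c} \<longleftrightarrow> rearr M p q {x\<in>J. \<kappa> x = c}"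
          by (rule rearr_cong) (use q_same in auto)
        then show ?thesis using Q_pos[of c] unfolding K_def by simp
      qed
      show "p x < p y" if "x \<in> J" "y \<in> J" "p (\<kappa> x) < p (\<kappa> y)" for x y
        using border[OF that(1,2)] that(3) by (cases "\<kappa> x = \<kappa> y") simp_all
      show "q x < q y" if "x \<in> J" "y \<in> J" "m (\<kappa> x) < m (\<kappa> y)" for x y
      proof -
        have "m (\<kappa> x) = m x" "m (\<kappa> y) = m y" using m_eq \<kappa> that by auto
        then show ?thesis using q that by auto
      qed
    qed (use finJ injJ q_inj in auto)
    have gq: "q x < q y" if "x \<in> J" "y \<in> J" "?g x < ?g y" for x y
      using q_diff[of x y] \<kappa>g[of x y] that by auto
    have val: "rearr N q v {x\<in>J. ?g x = \<gamma>}" for \<gamma>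
    proof -
      define G where "G = {x\<in>J. ?g x = \<gamma>}"
      have GJ: "G \<subseteq> J" unfolding G_def by simp
      \<comment> \<open>\<open>\<rho>\<close> labels the points of one block that share a gap of the
        rest of \<open>J\<close>. A point of another block cannot come between them in value,
        because it would split that gap.\<close>
      define \<rho> where "\<rho> x = (SOME y. y \<in> J \<and> \<kappa> y = \<kappa> x \<and> h (\<kappa> y) y = h (\<kappa> x) x)" for x
      have \<rho>: "\<rho> x \<in> J \<and> \<kappa> (\<rho> x) = \<kappa> x \<and> h (\<kappa> x) (\<rho> x) = h (\<kappa> x) x" if "x \<in> J" for x
      proof -
        have "\<rho> x \<in> J \<and> \<kappa> (\<rho> x) = \<kappa> x \<and> h (\<kappa> (\<rho> x)) (\<rho> x) = h (\<kappa> x) x"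
          unfolding \<rho>_def by (rule someI[of _ x]) (use that in simp)
        then show ?thesis by auto
      qed
      have \<rho>_eq: "\<rho> x = \<rho> y \<longleftrightarrow> \<kappa> x = \<kappa> y \<and> h (\<kappa> x) x = h (\<kappa> x) y" if "x \<in> J" "y \<in> J" for x y
      proof
        assume "\<rho> x = \<rho> y"
        then show "\<kappa> x = \<kappa> y \<and> h (\<kappa> x) x = h (\<kappa> x) y" using \<rho>[OF that(1)] \<rho>[OF that(2)] by metis
      next
        assume "\<kappa> x = \<kappa> y \<and> h (\<kappa> x) x = h (\<kappa> x) y"
        then have "h (\<kappa> x) x = h (\<kappa> y) y" "\<kappa> x = \<kappa> y" by auto
        then show "\<rho> x = \<rho> y" unfolding \<rho>_def by (simp only:)
      qed
      have \<rho>\<rho>: "\<rho> (\<rho> x) = \<rho> x" if "x \<in> J" for x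
        using \<rho>_eq[of "\<rho> x" x] \<rho>[of x] that by simp
      have \<rho>G: "\<rho> x \<in> G \<and> \<rho> (\<rho> x) = \<rho> x" if "x \<in> G" for x
        using \<rho>[of x] \<rho>\<rho>[of x] \<kappa>g[of "\<rho> x" x] that unfolding G_def by auto
      have h_conv: "\<rho> w = \<rho> x" if w: "x \<in> G" "y \<in> G" "w \<in> G" "\<rho> x = \<rho> y" "v x < v w" "v w < v y" for x y w
      proof -
        have xy: "x \<in> J" "y \<in> J" "w \<in> J" "\<kappa> x = \<kappa> y" "h (\<kappa> x) x = h (\<kappa> x) y"
          using w GJ \<rho>_eq[of x y] by auto
        have "\<kappa> w = \<kappa> x"
        proof (rule ccontr)
          assume "\<kappa> w \<noteq> \<kappa> x"
          then have "h (\<kappa> x) x < h (\<kappa> x) y"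
            unfolding h_def using finJ w xy by (intro gap_less[of _ w]) (auto simp: K_def)
          then show False using xy by simp
        qed
        moreover have "h (\<kappa> x) x \<le> h (\<kappa> x) w" "h (\<kappa> x) w \<le> h (\<kappa> x) y"
          unfolding h_def using finJ w by (auto intro!: gap_mono)
        ultimately show ?thesis using \<rho>_eq xy by auto
      qed
      have injG: "inj_on v G" "inj_on q G" using injJ(2) q_inj GJ by (auto intro: inj_on_subset)
      have "\<forall>x\<in>G. \<rho> x \<in> G \<and> \<rho> (\<rho> x) = \<rho> x"
        "\<forall>x\<in>G. \<forall>y\<in>G. \<forall>w\<in>G. \<rho> x = \<rho> y \<longrightarrow> v x < v w \<longrightarrow> v w < v y \<longrightarrow> \<rho> w = \<rho> x"
        using \<rho>G h_conv by blast+
      note hborder = block_order[OF injG(1) this]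
      have sub: "\<rho> ` G \<subseteq> G" using \<rho>G by auto
      \<comment> \<open>Distinct labels of one block lie in different gaps \<open>h\<close>, and
        both orders follow these gaps.\<close>
      have q_v: "q c < q d \<longleftrightarrow> v c < v d" if cd: "c \<in> \<rho> ` G" "d \<in> \<rho> ` G" "\<kappa> c = \<kappa> d" for c d
      proof (cases "c = d")
        case False
        have cdG: "c \<in> G" "d \<in> G" "\<rho> c = c" "\<rho> d = d" using cd \<rho>G by auto
        then have cdJ: "c \<in> J" "d \<in> J" "c \<in> K (\<kappa> c)" "d \<in> K (\<kappa> c)" using GJ cd unfolding K_def by auto
        then have "h (\<kappa> c) c \<noteq> h (\<kappa> c) d" using False \<rho>_eq cd cdG by metis
        then consider "h (\<kappa> c) c < h (\<kappa> c) d" | "h (\<kappa> c) d < h (\<kappa> c) c" by linarith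
        then show ?thesis
        proof cases
          case 1
          then have "v c < v d" by (rule h_less)
          moreover have "q c < q d" using q_same[OF cdJ(1,2) cd(3)] Q_gap[OF cdJ(3,4) 1] by simp
          ultimately show ?thesis by simp
        next
          case 2
          then have "v d < v c" by (rule h_less)
          moreover have "q d < q c" using q_same[OF cdJ(2,1)] cd(3) Q_gap[OF cdJ(4,3) 2] by simp
          ultimately show ?thesis by simp
        qed
      qed simp
      have "rearr N q v (\<rho> ` G)"
        using alt
      proof
        assume *: "\<forall>x\<in>J. \<forall>y\<in>J. \<kappa> x \<noteq> \<kappa> y \<longrightarrow> ?g x = ?g y \<longrightarrow> p x < p y \<longrightarrow>
          (\<exists>w\<in>J. ?g w \<noteq> ?g x \<and> p x < p w \<and> p w < p y)"
        show ?thesis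
        proof (rule mu[of _ "J - G"])
          show "\<rho> ` G \<subseteq> X" "J - G \<subseteq> X" using sub GJ less.prems(1) by auto
          \<comment> \<open>Points outside \<open>G\<close> lie in other gaps of \<open>Z\<close>,
            hence above or below all of \<open>G\<close>.\<close>
          have side: "(\<forall>r\<in>\<rho> ` G. v z < v r) \<or> (\<forall>r\<in>\<rho> ` G. v r < v z)" if z: "z \<in> J - G" for z
          proof -
            have "?g r = \<gamma>" if "r \<in> \<rho> ` G" for r using sub that unfolding G_def by auto
            moreover have "?g z \<noteq> \<gamma>" using z unfolding G_def by auto
            ultimately show ?thesis
              using gap_less_imp_less[OF finZ] by (metis linorder_neqE_nat)
          qed
          \<comment> \<open>Points of \<open>G\<close> in different blocks are separated in position
            by a point outside \<open>G\<close>, those in one block are not. So the position gaps of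
            \<open>J - G\<close> recover the blocks, and \<open>q\<close> is coarse with positions
            and values exchanged.\<close>
          have lt: "gap p (J - G) c < gap p (J - G) d"
            if cd: "c \<in> G" "d \<in> G" "\<kappa> c \<noteq> \<kappa> d" "p c < p d" for c d
          proof -
            have "c \<in> J" "d \<in> J" "?g c = \<gamma>" "?g c = ?g d" using cd unfolding G_def by auto
            then obtain w where w: "w \<in> J" "?g w \<noteq> ?g c" "p c < p w" "p w < p d"
              using * cd(3,4) by blast
            then have "w \<in> J - G" using \<open>?g c = \<gamma>\<close> unfolding G_def by simp
            then show ?thesis using gap_less[of "J - G" w p c d] w finJ by simp
          qed
          have eq: "gap p (J - G) c \<le> gap p (J - G) d" if cd: "c \<in> G" "d \<in> G" "\<kappa> c = \<kappa> d" for c d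
          proof (rule ccontr)
            assume "\<not> ?thesis"
            then obtain w where w: "w \<in> J - G" "p d \<le> p w" "p w < p c"
              using gap_less_separated[of "J - G" p d c] finJ by auto
            have "p d \<noteq> p w" using w cd injJ(1) GJ by (auto dest: inj_onD)
            then have "\<kappa> w = \<kappa> d" using conv[of d c w] w cd GJ by auto
            then show False using \<kappa>g[of w d] w cd unfolding G_def by auto
          qed
          have iff: "q c < q d \<longleftrightarrow> gap p (J - G) c < gap p (J - G) d \<or>
              gap p (J - G) c = gap p (J - G) d \<and> v c < v d"
            if cd: "c \<in> \<rho> ` G" "d \<in> \<rho> ` G" for c d
          proof (cases "\<kappa> c = \<kappa> d")
            case True
            have "c \<in> G" "d \<in> G" using cd sub by auto
            then have "gap p (J - G) c = gap p (J - G) d"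
              using eq[of c d] eq[of d c] True by simp
            then show ?thesis using q_v[OF cd True] by simp
          next
            case False
            have cdG: "c \<in> G" "d \<in> G" using cd sub by auto
            then have "q c < q d \<longleftrightarrow> p c < p d"
              using q_diff[OF _ _ False] border[OF _ _ False] unfolding G_def by auto
            moreover have "p c \<noteq> p d" using False cdG GJ injJ(1) by (auto dest: inj_onD)
            ultimately show ?thesis using lt[of c d] lt[of d c] cdG False by (metis less_asym linorder_neqE_nat less_irrefl_nat)
          qed
          show "coarse v p (\<rho> ` G) (J - G) q"
            unfolding coarse_def using side iff by blast
        qed
      next
        assume "\<exists>a b. \<forall>x\<in>J. \<kappa> x = a \<or> \<kappa> x = b"
        then obtain a b where ab: "\<forall>x\<in>J. \<kappa> x = a \<or> \<kappa> x = b" by blast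
        \<comment> \<open>One bit of colour tells the two blocks apart, which costs four
          steps.\<close>
        have "rearr (4 * 1) q v (\<rho> ` G)"
        proof (rule rearr_colour[of _ "\<lambda>x. if \<kappa> x = a then 0 else 1"])
          show "v x < v y" if "x \<in> \<rho> ` G" "y \<in> \<rho> ` G"
            "(if \<kappa> x = a then 0 else 1 :: nat) = (if \<kappa> y = a then 0 else 1)" "q x < q y" for x y
          proof -
            have "x \<in> J" "y \<in> J" using that sub GJ by auto
            then have "\<kappa> x = \<kappa> y" using ab that(3) by (auto split: if_splits)
            then show ?thesis using q_v that by blast
          qed
        qed (use injG sub in \<open>auto intro: inj_on_subset\<close>)
        then show ?thesis using N by (auto intro: rearr_mono)
      qed
      then have "rearr N q v G"
      proof (rule rearr_subst[of G q v q \<rho> v N, rotated 5])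
        show "finite G" using finJ GJ finite_subset by blast
        show "inj_on q G" "inj_on v G" by (fact injG)+
        show "inj_on q (\<rho> ` G)" "inj_on v (\<rho> ` G)" using injG sub by (auto intro: inj_on_subset)
        show "rearr N q v {x\<in>G. \<rho> x = c}" if c: "c \<in> \<rho> ` G" for c
        proof -
          have cG: "c \<in> G" "\<rho> c = c" using c \<rho>G by auto
          \<comment> \<open>The classes of \<open>\<rho>\<close> are the gap classes inside one
            block, already treated by the induction.\<close>
          have "x \<in> G \<and> \<rho> x = c \<longleftrightarrow> x \<in> K (\<kappa> c) \<and> h (\<kappa> c) x = h (\<kappa> c) c" for x
            using cG \<rho>_eq[of x c] \<kappa>g[of x c] unfolding G_def K_def by auto
          then have eq: "{x\<in>G. \<rho> x = c} = {x\<in>K (\<kappa> c). h (\<kappa> c) x = h (\<kappa> c) c}" by blast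
          have "rearr N (Q (\<kappa> c)) v {x\<in>G. \<rho> x = c} \<longleftrightarrow> rearr N q v {x\<in>G. \<rho> x = c}"
            unfolding eq by (rule rearr_cong) (use q_same in \<open>auto simp: K_def\<close>)
          then show ?thesis using Q_val[of "\<kappa> c"] unfolding eq by simp
        qed
        show "v x < v y" if "x \<in> G" "y \<in> G" "v (\<rho> x) < v (\<rho> y)" for x y
          using hborder[OF that(1,2)] that(3) by (cases "\<rho> x = \<rho> y") simp_all
        show "q x < q y" if xy: "x \<in> G" "y \<in> G" "q (\<rho> x) < q (\<rho> y)" for x y
        proof -
          have J: "x \<in> J" "y \<in> J" using xy GJ by auto
          show ?thesis
          proof (cases "\<kappa> x = \<kappa> y")
            case False
            have "?g x = ?g y" "?g (\<rho> x) = ?g (\<rho> y)" using xy \<rho>G unfolding G_def by auto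
            then show ?thesis
              using q_diff[OF J False] q_diff[of "\<rho> x" "\<rho> y"] \<rho>[OF J(1)] \<rho>[OF J(2)] False xy(3) by auto
          next
            case True
            have K: "x \<in> K (\<kappa> x)" "y \<in> K (\<kappa> x)" "\<rho> x \<in> K (\<kappa> x)" "\<rho> y \<in> K (\<kappa> x)"
              using J True \<rho>[OF J(1)] \<rho>[OF J(2)] unfolding K_def by auto
            have Q: "Q (\<kappa> x) (\<rho> x) < Q (\<kappa> x) (\<rho> y)"
              using q_same[of "\<rho> x" "\<rho> y"] xy(3) K unfolding K_def by auto
            have h: "h (\<kappa> x) (\<rho> x) = h (\<kappa> x) x" "h (\<kappa> x) (\<rho> y) = h (\<kappa> x) y"
              using \<rho>[OF J(1)] \<rho>[OF J(2)] True by auto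
            have "\<rho> x \<noteq> \<rho> y" using xy(3) by auto
            then have "h (\<kappa> x) x \<noteq> h (\<kappa> x) y" using \<rho>_eq[OF J] True by simp
            moreover have "\<not> h (\<kappa> x) y < h (\<kappa> x) x"
              using Q_gap[OF K(4,3)] Q h by auto
            ultimately have "Q (\<kappa> x) x < Q (\<kappa> x) y" using Q_gap[OF K(1,2)] by simp
            then show ?thesis using q_same[OF J True] by simp
          qed
        qed
      qed
      then show ?thesis unfolding G_def .
    qed
    show ?thesis
      by (intro exI[of _ q] conjI ballI allI impI) (use q_inj pos gq val in auto)
  qed
qed

text \<open>With \<open>Z\<close> empty all of \<open>X\<close> lies in gap 0, so the order
  \<open>q\<close> of \<open>refinement_exists\<close> leads from \<open>p\<close> to
  \<open>v\<close> on the whole of \<open>X\<close>.\<close>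

lemma rearr_coarse:
  fixes p v :: "'a \<Rightarrow> nat"
  assumes "finite X" "inj_on p X" "inj_on v X"
    and "\<And>R Z v'. R \<subseteq> X \<Longrightarrow> Z \<subseteq> X \<Longrightarrow> coarse p v R Z v' \<Longrightarrow> rearr M p v' R"
    and "\<And>R Z p'. R \<subseteq> X \<Longrightarrow> Z \<subseteq> X \<Longrightarrow> coarse v p R Z p' \<Longrightarrow> rearr N p' v R"
    and "4 \<le> N"
  shows "rearr (M + N) p v X"
proof -
  have "\<exists>q. inj_on q X \<and> rearr M p q X \<and>
      (\<forall>x\<in>X. \<forall>y\<in>X. gap v {} x < gap v {} y \<longrightarrow> q x < q y) \<and>
      (\<forall>\<gamma>. rearr N q v {x\<in>X. gap v {} x = \<gamma>})"
    by (rule refinement_exists[of X]) (use assms in simp_all)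
  then obtain q where q: "inj_on q X" "rearr M p q X" "rearr N q v {x\<in>X. gap v {} x = 0}"
    by blast
  have "{x\<in>X. gap v {} x = 0} = X" by (auto simp: gap_def)
  then have "rearr N q v X" using q(3) by simp
  then show ?thesis using rearr_trans q(1,2) assms(1) by blast
qed

section \<open>Recursion on the numbers of forbidden columns\<close>

lemma coarse_inj:
  assumes "coarse p v R Z v'" "inj_on p R"
  shows "inj_on v' R"
proof (rule inj_onI)
  fix x y assume xy: "x \<in> R" "y \<in> R" "v' x = v' y"
  then have "\<not> p x < p y" "\<not> p y < p x"
    using assms(1) unfolding coarse_def by (metis less_irrefl_nat linorder_neqE_nat)+
  then show "x = y" using xy assms(2) by (auto dest: inj_onD)
qed

text \<open>A grid in a coarse instance lifts to \<open>X\<close>, gaining a column in one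
  orientation and keeping its columns in the other. So the first factor lowers \<open>a\<close>, the
  second lowers \<open>b\<close>, and the length doubles per level. The forbidden number of rows
  grows by \<open>2 ^ (k + 2)\<close> per level, of which \<open>e\<close> bounds only the
  logarithm.\<close>

lemma rearr_if_no_grid:
  fixes p v :: "'a \<Rightarrow> nat"
  assumes "finite X" "inj_on p X" "inj_on v X" "\<not> grid a s p v X" "\<not> grid b s v p X"
    and "a \<le> k" "b \<le> k" "1 \<le> s" "1 \<le> e" "2 * s * 2 ^ ((k + 2) * (a + b)) \<le> 2 ^ e"
  shows "rearr (4 * e * 2 ^ (a + b)) p v X"
  using assms
proof (induction "a + b" arbitrary: a b s p v X rule: less_induct)
  case less
  have "2 * s * 1 \<le> 2 * s * 2 ^ ((k + 2) * (a + b))" by (rule mult_le_mono2) simp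
  then have s_le: "2 * s \<le> 2 ^ e" using less.prems(10) by linarith
  have le: "4 * e \<le> 4 * e * 2 ^ (a + b)" by simp
  show ?case
  proof (cases "a = 0 \<or> b = 0")
    case True
    \<comment> \<open>A forbidden grid without columns bounds the number of disjoint inversions; for
      \<open>b = 0\<close> the two orders are exchanged.\<close>
    then have "rearr (4 * e) p v X"
      using rearr_no_inversion_rows[of X p v s e] rearr_no_inversion_rows[of X v p s e, THEN rearr_sym]
        less.prems(1-5) s_le by auto
    then show ?thesis using le by (rule rearr_mono)
  next
    case False
    then obtain a' b' where ab: "a = Suc a'" "b = Suc b'" by (metis not0_implies_Suc)
    \<comment> \<open>The row count covers both losses: the factor 4 for a new column, and
      \<open>2 ^ c * Suc s\<close> with \<open>c \<le> k\<close> for the transposed grid.\<close>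
    define t where "t = 2 ^ (k + 2) * s"
    have t1: "1 \<le> t" "4 * s \<le> t" using less.prems(8) unfolding t_def by (simp_all add: power_add)
    have t2: "2 ^ c * Suc s \<le> t" if "c \<le> k" for c
    proof -
      have "2 ^ c * Suc s \<le> 2 ^ k * (4 * s)"
        using that less.prems(8) by (intro mult_le_mono power_increasing) auto
      then show ?thesis unfolding t_def by (simp add: power_add)
    qed
    have te: "2 * t * 2 ^ ((k + 2) * (a' + b)) \<le> 2 ^ e" "2 * t * 2 ^ ((k + 2) * (a + b')) \<le> 2 ^ e"
      using less.prems(10) unfolding t_def ab by (simp_all add: power_add algebra_simps)
    have "rearr (4 * e * 2 ^ (a' + b) + 4 * e * 2 ^ (a + b')) p v X"
    proof (rule rearr_coarse)
      fix R Z v' assume RZ: "R \<subseteq> X" "Z \<subseteq> X" and co: "coarse p v R Z v'"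
      have fin: "finite R" "finite Z" using RZ less.prems(1) finite_subset by auto
      have inj: "inj_on p R" using less.prems(2) RZ(1) by (rule inj_on_subset)
      show "rearr (4 * e * 2 ^ (a' + b)) p v' R"
      proof (rule less.hyps[of a' b R p v' t])
        show "\<not> grid a' t p v' R"
          using grid_coarse_values[OF fin(2) RZ less.prems(3) co, of a' s] grid_mono[OF _ t1(2)]
            less.prems(4) ab(1) by blast
        show "\<not> grid b t v' p R"
          using grid_coarse_positions[OF fin(2) RZ(1) co, of b s] grid_mono[OF _ t2]
            less.prems(5,7) by blast
      qed (use ab fin inj coarse_inj[OF co inj] less.prems te t1 in auto)
    next
      fix R Z p' assume RZ: "R \<subseteq> X" "Z \<subseteq> X" and co: "coarse v p R Z p'"
      have fin: "finite R" "finite Z" using RZ less.prems(1) finite_subset by auto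
      have inj: "inj_on v R" using less.prems(3) RZ(1) by (rule inj_on_subset)
      show "rearr (4 * e * 2 ^ (a + b')) p' v R"
      proof (rule less.hyps[of a b' R p' v t])
        show "\<not> grid b' t v p' R"
          using grid_coarse_values[OF fin(2) RZ less.prems(2) co, of b' s] grid_mono[OF _ t1(2)]
            less.prems(5) ab(2) by blast
        show "\<not> grid a t p' v R"
          using grid_coarse_positions[OF fin(2) RZ(1) co, of a s] grid_mono[OF _ t2]
            less.prems(4,6) by blast
      qed (use ab fin inj coarse_inj[OF co inj] less.prems te t1 in auto)
    qed (use less.prems in auto)
    moreover have "4 * e * 2 ^ (a' + b) + 4 * e * 2 ^ (a + b') = 4 * e * 2 ^ (a + b)"
      unfolding ab by simp
    ultimately show ?thesis by simp
  qed
qed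

section \<open>Pattern avoidance\<close>

text \<open>One point from the cell in column \<open>i\<close> and row \<open>\<pi> i\<close>, for
  every \<open>i\<close>, realizes the pattern. Cells are numbered from 0 and \<open>\<pi>\<close>
  from 1, hence the \<open>- 1\<close>.\<close>

lemma pattern_of_if_cells_nonempty:
  assumes \<pi>: "\<pi> permutes {1..n}" and sub: "\<And>i. i < n \<Longrightarrow> A i \<subseteq> {1..m}"
    and AA: "\<And>i j. i < j \<Longrightarrow> j < n \<Longrightarrow> before id (A i) (A j)"
    and BB: "\<And>i j. i < j \<Longrightarrow> j < n \<Longrightarrow> before \<sigma> (B i) (B j)"
    and AB: "\<And>i j. i < n \<Longrightarrow> j < n \<Longrightarrow> A i \<inter> B j \<noteq> {}"
  shows "pattern_of n \<pi> m \<sigma>"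
proof -
  have "\<exists>x. x \<in> A (i - 1) \<inter> B (\<pi> i - 1)" if "i \<in> {1..n}" for i
    using that permutes_in_image[OF \<pi>, of i] AB[of "i - 1" "\<pi> i - 1"] by fastforce
  then obtain f where f: "\<And>i. i \<in> {1..n} \<Longrightarrow> f i \<in> A (i - 1) \<inter> B (\<pi> i - 1)" by metis
  have mono: "f i < f j" if "i \<in> {1..n}" "j \<in> {1..n}" "i < j" for i j
  proof -
    have "before id (A (i - 1)) (A (j - 1))" using that by (intro AA) auto
    then show ?thesis using f[OF that(1)] f[OF that(2)] unfolding before_def by auto
  qed
  have val: "\<sigma> (f i) < \<sigma> (f j)" if "i \<in> {1..n}" "j \<in> {1..n}" "\<pi> i < \<pi> j" for i j
  proof -
    have "before \<sigma> (B (\<pi> i - 1)) (B (\<pi> j - 1))"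
      using that permutes_in_image[OF \<pi>, of i] permutes_in_image[OF \<pi>, of j]
      by (intro BB) auto
    then show ?thesis using f[OF that(1)] f[OF that(2)] unfolding before_def by auto
  qed
  have "\<pi> i < \<pi> j \<longleftrightarrow> \<sigma> (f i) < \<sigma> (f j)" if "i \<in> {1..n}" "j \<in> {1..n}" for i j
  proof (cases "\<pi> i" "\<pi> j" rule: linorder_cases)
    case less
    then show ?thesis using val that by blast
  next
    case equal
    then have "i = j" using permutes_inj[OF \<pi>] by (auto dest: injD)
    then show ?thesis by simp
  next
    case greater
    then show ?thesis using val[of j i] that by auto
  qed
  moreover have "f ` {1..n} \<subseteq> {1..m}"
  proof (rule image_subsetI)
    fix i assume i: "i \<in> {1..n}"
    then have "A (i - 1) \<subseteq> {1..m}" by (intro sub) auto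
    then show "f i \<in> {1..m}" using f[OF i] by blast
  qed
  moreover have "strict_mono_on {1..n} f" using mono by (intro strict_mono_onI) auto
  ultimately show ?thesis unfolding pattern_of_def by blast
qed

text \<open>Sorted by value, the positions are listed by \<open>inv \<sigma>\<close>. The entry
  \<open>i\<close> stands at position \<open>i\<close> of the first list and at position
  \<open>\<sigma> i\<close> of the second, so the factors compose to
  \<open>\<sigma>\<close>.\<close>

lemma separable_factors_if_rearr:
  assumes \<sigma>: "\<sigma> permutes {1..m}" and m: "1 \<le> m" and r: "rearr N id \<sigma> {1..m}"
  shows "\<exists>\<tau>s. length \<tau>s = N \<and> (\<forall>\<tau>\<in>set \<tau>s. separable m \<tau>) \<and> \<sigma> = foldr (\<circ>) \<tau>s id"
proof -
  let ?xs = "[1..<Suc m]" and ?ys = "map (inv \<sigma>) [1..<Suc m]"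
  have xs: "set ?xs = {1..m}" by auto
  have "enumerates id {1..m} ?xs"
    unfolding enumerates_def xs using sorted_wrt_upt by (simp del: upt_Suc)
  moreover have "enumerates \<sigma> {1..m} ?ys"
    unfolding enumerates_def set_map xs sorted_wrt_map
    using permutes_image[OF permutes_inv[OF \<sigma>]] sorted_wrt_upt
    by (simp add: permutes_inverses[OF \<sigma>] del: upt_Suc)
  ultimately have "(sep_rearr ^^ N) ?xs ?ys" using r unfolding rearr_def by blast
  then obtain \<tau>s where ts: "length \<tau>s = N" "\<forall>\<tau>\<in>set \<tau>s. separable (length ?xs) \<tau>"
    "\<forall>i<length ?xs. ?xs ! i = ?ys ! (foldr (\<circ>) \<tau>s id (Suc i) - 1)"
    using sep_rearr_pow_separable[of ?xs N ?ys] m by auto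
  have len: "length ?xs = m" by simp
  have F: "foldr (\<circ>) \<tau>s id permutes {1..m}"
    using ts(2) separable_permutes unfolding len by (intro foldr_comp_permutes) blast
  have "\<sigma> i = foldr (\<circ>) \<tau>s id i" for i
  proof (cases "i \<in> {1..m}")
    case True
    let ?j = "foldr (\<circ>) \<tau>s id i"
    have j: "?j \<in> {1..m}" using permutes_in_image[OF F] True by blast
    have "?xs ! (i - 1) = ?ys ! (foldr (\<circ>) \<tau>s id (Suc (i - 1)) - 1)"
      using ts(3) True unfolding len by auto
    moreover have "Suc (i - 1) = i" using True by auto
    moreover have "?xs ! (i - 1) = i" using True by (subst nth_upt) auto
    moreover have "?ys ! (?j - 1) = inv \<sigma> (?xs ! (?j - 1))" using j by (intro nth_map) auto
    moreover have "?xs ! (?j - 1) = ?j" using j by (subst nth_upt) auto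
    ultimately have "i = inv \<sigma> ?j" by metis
    then show ?thesis using permutes_inverses(1)[OF \<sigma>] by metis
  next
    case False
    then show ?thesis using permutes_not_in[OF \<sigma>] permutes_not_in[OF F] by metis
  qed
  then show ?thesis using ts(1,2) unfolding len by (intro exI[of _ \<tau>s]) blast
qed

section \<open>Numerical estimate of the number of factors\<close>

lemma factor_count_bound:
  assumes "1 \<le> n"
  shows "4 * (n + 1 + (n + 2) * (n + n)) * 2 ^ (n + n) \<le> (2 ^ (2 ^ (5 * n)) :: nat)"
proof -
  have n: "n \<le> 2 ^ n" using less_exp[of n] by simp
  have "n \<le> n * n" "1 \<le> n * n" using assms by simp_all
  moreover have "n + 1 + (n + 2) * (n + n) = 2 * (n * n) + 5 * n + 1"
    by (simp add: algebra_simps)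
  ultimately have "n + 1 + (n + 2) * (n + n) \<le> 8 * (n * n)" by linarith
  also have "\<dots> \<le> 8 * (2 ^ n * 2 ^ n)" using n by (intro mult_le_mono) auto
  finally have "4 * (n + 1 + (n + 2) * (n + n)) * 2 ^ (n + n) \<le> 4 * (8 * (2 ^ n * 2 ^ n)) * 2 ^ (n + n)"
    by (intro mult_le_mono) auto
  also have "\<dots> = 2 ^ (2 + (3 + (n + n)) + (n + n))" unfolding power_add by simp
  also have "2 + (3 + (n + n)) + (n + n) = 4 * n + 5" by simp
  \<comment> \<open>The count is bounded by a single exponential, whose exponent is below
    \<open>2 ^ (5 * n)\<close> for every positive \<open>n\<close>.\<close>
  also have "2 ^ (4 * n + 5) \<le> (2 ^ (2 ^ (5 * n)) :: nat)"
  proof (rule power_increasing)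
    have "4 * n + 5 \<le> 16 * n" using assms by simp
    also have "\<dots> \<le> 2 ^ 4 * 2 ^ n" using n by simp
    also have "\<dots> = 2 ^ (4 + n)" by (simp add: power_add)
    also have "\<dots> \<le> 2 ^ (5 * n)" using assms by (intro power_increasing) auto
    finally show "4 * n + 5 \<le> 2 ^ (5 * n)" .
  qed simp
  finally show ?thesis .
qed

theorem theorem1p1:
  shows "\<exists>C::nat. \<forall>n::nat. \<forall>\<pi>::nat \<Rightarrow> nat. n \<ge> 1 \<longrightarrow> \<pi> permutes {1..n} \<longrightarrow>
    (\<exists>k::nat. k \<le> 2 ^ (2 ^ (C * n)) \<and>
      (\<forall>m::nat. \<forall>\<sigma>::nat \<Rightarrow> nat. m \<ge> 1 \<longrightarrow> \<sigma> permutes {1..m} \<longrightarrow> avoids m \<sigma> n \<pi> \<longrightarrow>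
        (\<exists>\<tau>s::(nat \<Rightarrow> nat) list. \<tau>s \<noteq> [] \<and> length \<tau>s \<le> k \<and>
          (\<forall>\<tau>\<in>set \<tau>s. separable m \<tau>) \<and> \<sigma> = foldr (\<circ>) \<tau>s id)))"
proof (rule exI[of _ 5], intro allI impI)
  fix n :: nat and \<pi> :: "nat \<Rightarrow> nat"
  assume n: "1 \<le> n" and \<pi>: "\<pi> permutes {1..n}"
  \<comment> \<open>The recursion is run with \<open>a = b = s = k = n\<close>; as
    \<open>2 * n \<le> 2 ^ (n + 1)\<close>, this \<open>e\<close> meets its bound on rows.\<close>
  define e where "e = n + 1 + (n + 2) * (n + n)"
  define k where "k = 4 * e * 2 ^ (n + n)"
  have "\<exists>\<tau>s. \<tau>s \<noteq> [] \<and> length \<tau>s \<le> k \<and> (\<forall>\<tau>\<in>set \<tau>s. separable m \<tau>) \<and> \<sigma> = foldr (\<circ>) \<tau>s id"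
    if m: "1 \<le> m" and \<sigma>: "\<sigma> permutes {1..m}" and av: "avoids m \<sigma> n \<pi>" for m \<sigma>
  proof -
    have "rearr k id \<sigma> {1..m}"
      unfolding k_def
    proof (rule rearr_if_no_grid[where s = n and k = n])
      show "inj_on \<sigma> {1..m}" using permutes_inj[OF \<sigma>] by (rule inj_on_subset) simp
      show "\<not> grid n n id \<sigma> {1..m}"
      proof
        assume "grid n n id \<sigma> {1..m}"
        then have "pattern_of n \<pi> m \<sigma>"
          by (rule gridE) (rule pattern_of_if_cells_nonempty[OF \<pi>]; assumption)
        then show False using av unfolding avoids_def by blast
      qed
      show "\<not> grid n n \<sigma> id {1..m}"
      proof
        assume "grid n n \<sigma> id {1..m}"
        then have "pattern_of n \<pi> m \<sigma>"
        proof (rule gridE)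
          fix C W
          assume CW: "\<And>l. l < n \<Longrightarrow> W l \<subseteq> {1..m}"
            "\<And>i j. i < j \<Longrightarrow> j < n \<Longrightarrow> before \<sigma> (C i) (C j)"
            "\<And>k l. k < l \<Longrightarrow> l < n \<Longrightarrow> before id (W k) (W l)"
            "\<And>i l. i < n \<Longrightarrow> l < n \<Longrightarrow> C i \<inter> W l \<noteq> {}"
          \<comment> \<open>In the transposed grid \<open>W\<close> runs along positions and
            \<open>C\<close> along values.\<close>
          show ?thesis
            by (rule pattern_of_if_cells_nonempty[OF \<pi> CW(1,3,2)], assumption+)
              (subst Int_commute, rule CW(4))
        qed
        then show False using av unfolding avoids_def by blast
      qed
      have "2 * n \<le> 2 ^ (n + 1)" using less_exp[of n] by simp
      then have "2 * n * 2 ^ ((n + 2) * (n + n)) \<le> 2 ^ (n + 1) * 2 ^ ((n + 2) * (n + n))"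
        by (rule mult_le_mono1)
      then show "2 * n * 2 ^ ((n + 2) * (n + n)) \<le> 2 ^ e"
        unfolding e_def by (simp only: power_add)
    qed (use n in \<open>auto simp: e_def\<close>)
    then obtain \<tau>s where "length \<tau>s = k" "\<forall>\<tau>\<in>set \<tau>s. separable m \<tau>" "\<sigma> = foldr (\<circ>) \<tau>s id"
      using separable_factors_if_rearr[OF \<sigma> m] by blast
    moreover have "k \<noteq> 0" unfolding k_def e_def by simp
    ultimately show ?thesis by (intro exI[of _ \<tau>s]) auto
  qed
  moreover have "k \<le> 2 ^ (2 ^ (5 * n))"
    using factor_count_bound[OF n] unfolding k_def e_def .
  ultimately show "\<exists>k\<le>2 ^ (2 ^ (5 * n)). \<forall>m \<sigma>. 1 \<le> m \<longrightarrow> \<sigma> permutes {1..m} \<longrightarrow> avoids m \<sigma> n \<pi> \<longrightarrow>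
      (\<exists>\<tau>s. \<tau>s \<noteq> [] \<and> length \<tau>s \<le> k \<and> (\<forall>\<tau>\<in>set \<tau>s. separable m \<tau>) \<and> \<sigma> = foldr (\<circ>) \<tau>s id)"
    by blast
qed

end
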